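(* Let $D$ be the generator of a strongly continuous one-parameter group of isometries $e^{tD}$, $t\in\mathbb{R}$, in a complex Banach space $E$, and let $\sigma>0$. If $f\in\mathbf{B}_\sigma(D)$, then for all $t\in\mathbb{R}$ $$e^{tD}f=f+t\,\mathrm{sinc}\Big(\frac{\sigma t}{\pi}\Big)Df+t\sum_{k\in\mathbb{Z}\setminus\{0\}}\frac{e^{\frac{k\pi}{\sigma}D}f-f}{\frac{k\pi}{\sigma}}\,\mathrm{sinc}\Big(\frac{\sigma t}{\pi}-k\Big)$$ and $$f=e^{tD}f-t\,\mathrm{sinc}\Big(\frac{\sigma t}{\pi}\Big)e^{tD}Df-t\sum_{k\in\mathbb{Z}\setminus\{0\}}\frac{e^{\left(\frac{k\pi}{\sigma}+t\right)D}f-e^{tD}f}{\frac{k\pi}{\sigma}}\,\mathrm{sinc}\Big(\frac{\sigma t}{\pi}+k\Big),$$ where both series $\sum_{k\ne0}$ (without the prefactor $t$) converge in the norm of $E$ uniformly with respect to $t\in\mathbb{R}$.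
   Context: $\mathcal{D}^\infty$ is the intersection of the domains of all powers $D^k$, $k\in\mathbb{N}$. $\mathbf{B}_\sigma(D)$ is the set of all $f\in\mathcal{D}^\infty$ such that $\|D^kf\|\le\sigma^k\|f\|$ for all $k\in\mathbb{N}=\{1,2,\dots\}$. $\mathrm{sinc}(x)=\frac{\sin\pi x}{\pi x}$ for $x\ne0$, $\mathrm{sinc}(0)=1$. *)

theory Defs
  imports "HOL-Analysis.Analysis"
begin

class complex_banach = banach +
  fixes scaleC :: "complex \<Rightarrow> 'a \<Rightarrow> 'a"  (infixr \<open>*\<^sub>C\<close> 75)
  assumes scaleC_add_right: "a *\<^sub>C (x + y) = a *\<^sub>C x + a *\<^sub>C y"
    and scaleC_add_left: "(a + b) *\<^sub>C x = a *\<^sub>C x + b *\<^sub>C x"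
    and scaleC_scaleC: "a *\<^sub>C (b *\<^sub>C x) = (a * b) *\<^sub>C x"
    and scaleC_of_real: "complex_of_real r *\<^sub>C x = r *\<^sub>R x"
    and norm_scaleC: "norm (a *\<^sub>C x) = cmod a * norm x"

locale isometry_group =
  fixes U :: "real \<Rightarrow> 'a::complex_banach \<Rightarrow> 'a"
  assumes add: "U t (x + y) = U t x + U t y"
    and scaleC: "U t (a *\<^sub>C x) = a *\<^sub>C U t x"
    and norm: "norm (U t x) = norm x"
    and zero: "U 0 x = x"
    and group: "U (s + t) x = U s (U t x)"
    and strongly_continuous: "continuous_on UNIV (\<lambda>t. U t x)"

text \<open>An operator that need not be everywhere defined is a partial function
  \<^typ>\<open>'a \<Rightarrow> 'a option\<close>; its domain is \<^const>\<open>dom\<close>.\<close>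

definition generator :: "(real \<Rightarrow> 'a::complex_banach \<Rightarrow> 'a) \<Rightarrow> 'a \<Rightarrow> 'a option" where
  "generator U x =
    (let q = (\<lambda>t. (U t x - x) /\<^sub>R t)
     in if \<exists>y. (q \<longlongrightarrow> y) (at 0) then Some (Lim (at 0) q) else None)"

primrec op_power :: "('a \<Rightarrow> 'a option) \<Rightarrow> nat \<Rightarrow> 'a \<Rightarrow> 'a option" where
  "op_power D 0 = Some"
| "op_power D (Suc k) = D \<circ>\<^sub>m op_power D k"

definition smooth_domain :: "('a \<Rightarrow> 'a option) \<Rightarrow> 'a set" where
  "smooth_domain D = (\<Inter>k. dom (op_power D k))"

definition bernstein_space :: "real \<Rightarrow> ('a::complex_banach \<Rightarrow> 'a option) \<Rightarrow> 'a set" where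
  "bernstein_space \<sigma> D =
    {f \<in> smooth_domain D. \<forall>k\<ge>1. norm (the (op_power D k f)) \<le> \<sigma> ^ k * norm f}"

definition sinc :: "real \<Rightarrow> real" where
  "sinc x = (if x = 0 then 1 else sin (pi * x) / (pi * x))"

end

theory Submission
  imports Defs "HOL-Complex_Analysis.Complex_Analysis"
begin

text \<open>
  After rescaling to \<open>\<sigma> = 1\<close>, the orbit \<open>t \<mapsto> e\<^bsup>tD\<^esup>f\<close> extends to the entire function
  \<open>G(z) = \<Sum>\<^sub>n z\<^sup>n/n! D\<^sup>nf\<close>, and \<open>\<parallel>G(x + iy)\<parallel> = \<parallel>G(iy)\<parallel> \<le> e\<^bsup>\<bar>y\<bar>\<^esup>\<parallel>f\<parallel>\<close> because the group acts
  by isometries. Hence \<open>H(z) = (G(z) - f)/z\<close> has size at most \<open>2 e\<^bsup>\<bar>y\<bar>\<^esup>\<parallel>f\<parallel>/\<bar>z\<bar>\<close>, and the integral of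
  \<open>H(z)/((z - x) sin z)\<close> over the circle of radius \<open>(N + 1/2)\<pi>\<close> is of order \<open>1/N\<close>. Its residues
  give the cardinal series of \<open>H\<close>, which is the first formula. The second one is \<open>e\<^bsup>tD\<^esup>\<close> applied to
  the first one at \<open>-t\<close>. Uniform convergence follows from the Cauchy-Schwarz inequality, as
  \<open>\<Sum>\<^sub>k sinc(x - k)\<^sup>2\<close> is bounded uniformly in \<open>x\<close> and the difference quotients are of order \<open>1/k\<close>.
\<close>

subsection \<open>The sampling kernel on large circles\<close>

text \<open>Since \<open>g z = 0\<close>, the product of \<open>f w / g w\<close> and
  \<open>w - z\<close> is \<open>f w\<close> divided by the difference quotient of \<open>g\<close>.
  The case \<open>f z = 0\<close> is included: the singularity is then removable and both sides
  vanish, as happens for a monomial at the node 0.\<close>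

lemma residue_divide_simple_zero:
  fixes f g :: "complex \<Rightarrow> complex"
  assumes "f holomorphic_on S" "g holomorphic_on S" "open S" "z \<in> S"
    and "\<And>w. w \<in> S - {z} \<Longrightarrow> g w \<noteq> 0"
    and "g z = 0" "(g has_field_derivative g') (at z)" "g' \<noteq> 0"
  shows "residue (\<lambda>w. f w / g w) z = f z / g'"
proof (rule residue_simple')
  show "open S" "z \<in> S" by fact+
  show "(\<lambda>w. f w / g w) holomorphic_on S - {z}"
    using assms by (intro holomorphic_intros) (auto intro: holomorphic_on_subset)
  have "isCont f z"
    using assms(1,3,4) holomorphic_on_imp_continuous_on continuous_on_eq_continuous_at by blast
  moreover have "((\<lambda>w. (g w - g z) / (w - z)) \<longlongrightarrow> g') (at z)"
    using assms(7) by (simp add: has_field_derivative_iff)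
  ultimately have "((\<lambda>w. f w / ((g w - g z) / (w - z))) \<longlongrightarrow> f z / g') (at z)"
    using \<open>g' \<noteq> 0\<close> by (intro tendsto_divide) (auto simp: isCont_def)
  then show "((\<lambda>w. f w / g w * (w - z)) \<longlongrightarrow> f z / g') (at z)"
    using \<open>g z = 0\<close> by (simp add: algebra_simps)
qed

text \<open>All zeros of the complex sine are integer multiples of pi, so a zero on this circle
  would make an odd integer even.\<close>

lemma circle_half_odd_avoids_sin_zeros:
  assumes "cmod z = (real N + 1/2) * pi"
  shows "sin z \<noteq> 0"
proof
  assume "sin z = 0"
  then obtain n :: int where "z = of_real (n * pi)"
    by (auto simp: sin_eq_0)
  then have "cmod z = \<bar>real_of_int n\<bar> * pi"
    by (metis abs_mult abs_of_nonneg norm_of_real pi_ge_zero)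
  with assms have "\<bar>real_of_int n\<bar> = real N + 1/2"
    by simp
  then have "real_of_int (2 * \<bar>n\<bar>) = real_of_int (2 * int N + 1)"
    by simp
  then show False
    unfolding of_int_eq_iff by presburger
qed

text \<open>The circle encloses exactly the poles \<open>x\<close> and \<open>k * pi\<close> with
  |k| \<le> N, all of them simple. Monomials suffice as numerators because the vector-valued
  integral is later evaluated coefficient by coefficient.\<close>

lemma contour_integral_sampling_kernel:
  fixes x :: real
  assumes sinx: "sin x \<noteq> 0" and xR: "\<bar>x\<bar> < (real N + 1/2) * pi"
  shows "contour_integral (circlepath 0 ((real N + 1/2) * pi)) (\<lambda>z. z ^ n / ((z - of_real x) * sin z)) =
    2 * pi * \<i> * of_real (x ^ n / sin x + (\<Sum>k=-int N..int N. (k * pi) ^ n / ((k * pi - x) * cos (k * pi))))"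
proof -
  define R where "R = (real N + 1/2) * pi"
  define P where "P = (\<lambda>k::int. complex_of_real (k * pi)) ` {-int N..int N}"
  define g where "g z = (z - complex_of_real x) * sin z" for z
  \<comment> \<open>The open disc contains the closed disc of radius \<open>R\<close>, while the
    next zeros of the sine, of modulus \<open>(N + 1) * pi\<close>, lie on its boundary and are
    excluded.\<close>
  define S where "S = ball (0::complex) ((real N + 1) * pi)"
  have R: "R > 0" "R < (real N + 1) * pi" by (auto simp: R_def intro!: mult_pos_pos add_nonneg_pos)
  have xk: "x \<noteq> of_int k * pi" for k
    using sinx by (auto simp: sin_times_pi_eq_0)
  have inj: "inj_on (\<lambda>k::int. complex_of_real (k * pi)) A" for A
    by (auto simp: inj_on_def)
  have g0: "g z \<noteq> 0" if z: "z \<in> S - insert (of_real x) P" for z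
  proof
    assume "g z = 0"
    with z have "sin z = 0" by (auto simp: g_def)
    then obtain k :: int where k: "z = of_real (k * pi)" by (auto simp: sin_eq_0)
    then have "cmod z = \<bar>real_of_int k\<bar> * pi"
      by (metis abs_mult abs_of_nonneg norm_of_real pi_ge_zero)
    with z have "\<bar>real_of_int k\<bar> < real N + 1" by (auto simp: S_def)
    then have "k \<in> {-int N..int N}" by auto
    with z k show False unfolding P_def by blast
  qed
  have holo: "g holomorphic_on A" for A
    unfolding g_def by (intro holomorphic_intros)
  have nP: "cmod p < R" if p: "p \<in> insert (of_real x) P" for p
  proof (cases "p = of_real x")
    case True then show ?thesis using xR by (simp add: R_def)
  next
    case False
    with p obtain k :: int where k: "k \<in> {-int N..int N}" "p = of_real (k * pi)" by (auto simp: P_def)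
    then have "cmod p = \<bar>real_of_int k\<bar> * pi"
      by (metis abs_mult abs_of_nonneg norm_of_real pi_ge_zero)
    also have "\<bar>real_of_int k\<bar> \<le> real N" using k by auto
    then have "\<bar>real_of_int k\<bar> * pi < R" by (simp add: R_def)
    finally show ?thesis .
  qed
  \<comment> \<open>The denominator is the derivative of \<open>g\<close> at \<open>p\<close>. One
    formula serves both kinds of poles: its second term vanishes at \<open>x\<close>, its first one
    at the nodes \<open>k * pi\<close>.\<close>
  have res: "residue (\<lambda>z. z ^ n / g z) p = p ^ n / (sin p + (p - of_real x) * cos p)"
    if p: "p \<in> insert (of_real x) P" for p
  proof (rule residue_divide_simple_zero)
    let ?S = "S - (insert (of_real x) P - {p})"
    show "open ?S" by (intro open_Diff finite_imp_closed) (auto simp: S_def P_def)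
    show "p \<in> ?S" using nP[OF p] R by (simp add: S_def)
    show "g w \<noteq> 0" if "w \<in> ?S - {p}" for w using g0[of w] that by blast
    have *: "p = of_real x \<or> (\<exists>k::int. p = of_real (k * pi))" using p by (auto simp: P_def)
    then show "g p = 0"
      by (auto simp: g_def sin_of_real sin_times_pi_eq_0 simp del: of_real_mult)
    show "(g has_field_derivative sin p + (p - of_real x) * cos p) (at p)"
      unfolding g_def by (auto intro!: derivative_eq_intros)
    show "sin p + (p - of_real x) * cos p \<noteq> 0"
      using *
    proof
      assume "p = of_real x" then show ?thesis using sinx by (simp add: sin_of_real)
    next
      assume "\<exists>k::int. p = of_real (k * pi)"
      then obtain k :: int where k: "p = of_real (k * pi)" by blast
      have "cos (k * pi) \<noteq> 0"
        using cos_npi_int[of k] by (simp add: mult.commute split: if_splits)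
      moreover have "p \<noteq> of_real x" using xk[of k] k by (metis of_real_eq_iff)
      moreover have "sin (k * pi) = 0" by (simp add: sin_times_pi_eq_0)
      ultimately show ?thesis using k
        by (simp add: sin_of_real cos_of_real del: of_real_mult)
    qed
  qed (auto intro!: holomorphic_intros holo)
  have "contour_integral (circlepath 0 R) (\<lambda>z. z ^ n / g z)
    = 2 * pi * \<i> * (\<Sum>p\<in>insert (of_real x) P. winding_number (circlepath 0 R) p * residue (\<lambda>z. z ^ n / g z) p)"
  proof (rule Residue_theorem)
    show "open S" "connected S" "finite (insert (of_real x) P)" by (auto simp: S_def P_def)
    show "(\<lambda>z. z ^ n / g z) holomorphic_on S - insert (complex_of_real x) P"
      by (intro holomorphic_intros holo g0)
    show "path_image (circlepath 0 R) \<subseteq> S - insert (of_real x) P"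
    proof
      fix z assume "z \<in> path_image (circlepath 0 R)"
      then have "cmod z = R" using R by simp
      with R nP[of z] show "z \<in> S - insert (of_real x) P" by (auto simp: S_def)
    qed
    show "\<forall>z. z \<notin> S \<longrightarrow> winding_number (circlepath 0 R) z = 0"
      using R by (auto simp: S_def intro!: winding_number_zero_outside[where s="cball 0 R"])
  qed auto
  also have "(\<Sum>p\<in>insert (of_real x) P. winding_number (circlepath 0 R) p * residue (\<lambda>z. z ^ n / g z) p)
    = (\<Sum>p\<in>insert (of_real x) P. p ^ n / (sin p + (p - of_real x) * cos p))"
  proof (intro sum.cong refl)
    fix p assume p: "p \<in> insert (of_real x) P"
    show "winding_number (circlepath 0 R) p * residue (\<lambda>z. z ^ n / g z) p = p ^ n / (sin p + (p - of_real x) * cos p)"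
      using nP[OF p] by (simp only: res[OF p]) (simp add: winding_number_circlepath)
  qed
  also have "\<dots> = (\<Sum>p\<in>P. p ^ n / (sin p + (p - of_real x) * cos p)) + of_real (x ^ n / sin x)"
  proof -
    have "complex_of_real x \<notin> P"
    proof
      assume "complex_of_real x \<in> P"
      then obtain k :: int where "complex_of_real x = of_real (k * pi)" unfolding P_def by blast
      then show False using xk[of k] by (simp only: of_real_eq_iff)
    qed
    then show ?thesis by (subst sum.insert) (auto simp: P_def sin_of_real)
  qed
  also have "(\<Sum>p\<in>P. p ^ n / (sin p + (p - of_real x) * cos p))
     = of_real (\<Sum>k=-int N..int N. (k * pi) ^ n / ((k * pi - x) * cos (k * pi)))"
  proof -
    have "sin (k * pi) = 0" for k :: int by (simp add: sin_times_pi_eq_0)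
    then show ?thesis
      unfolding P_def by (subst sum.reindex[OF inj])
        (simp add: sin_of_real cos_of_real del: of_real_mult flip: of_real_power of_real_diff, simp)
  qed
  finally show ?thesis by (simp add: R_def g_def add_ac)
qed

text \<open>With y = |Im z|, four times the squared modulus of \<open>sin z\<close> is exp(2y) +
  exp(-2y) - 2 cos(2 Re z). Far from the real axis the exponential dominates; near it, Re z is so
  close to the radius in absolute value that the cosine is not positive.\<close>

lemma norm_sin_ge_on_circle:
  assumes R: "cmod z = (real N + 1/2) * pi" and N: "N \<ge> 1"
  shows "exp \<bar>Im z\<bar> \<le> 4 * cmod (sin z)"
proof -
  define y where "y = \<bar>Im z\<bar>"
  have eq: "4 * (cmod (sin z))\<^sup>2 = exp (2 * y) + inverse (exp (2 * y)) - 2 * cos (2 * Re z)"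
    by (auto simp: norm_sin_squared y_def abs_if exp_minus)
  have "exp (2 * y) / 4 \<le> exp (2 * y) + inverse (exp (2 * y)) - 2 * cos (2 * Re z)"
  proof (cases "y \<ge> 1")
    case True
    \<comment> \<open>Here exp(2y) is at least 3, so three quarters of it already exceed 2, the
      largest value of the cosine term.\<close>
    have "exp (2 * y) \<ge> 1 + 2 * y" by (rule exp_ge_add_one_self)
    then have "exp (2 * y) * (3/4) \<ge> 9/4" using True by linarith
    then have "exp (2 * y) * (3/4) \<ge> 2 * cos (2 * Re z)" using cos_le_one[of "2 * Re z"] by linarith
    then show ?thesis using exp_gt_zero[of "-(2 * y)"] unfolding exp_minus by linarith
  next
    case False
    let ?R = "cmod z" and ?x = "\<bar>Re z\<bar>"
    \<comment> \<open>From (R - |Re z|)(R + |Re z|) = y^2 \<le> 1 and R \<ge> 3 follows R - |Re z|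
      \<le> 1/3, so the angle 2(R - |Re z|) stays below pi/2.\<close>
    have R3: "?R \<ge> 3" using N pi_gt3 mult_mono[of 1 "real N + 1/2" 3 pi] unfolding R by simp
    have "?R\<^sup>2 = ?x\<^sup>2 + y\<^sup>2" by (simp add: y_def cmod_power2)
    moreover have "y\<^sup>2 \<le> 1" using False by (simp add: y_def abs_square_le_1)
    ultimately have "(?R - ?x) * (?R + ?x) \<le> 1" by (simp add: algebra_simps power2_eq_square)
    moreover have "0 \<le> ?R - ?x" by (simp add: abs_Re_le_cmod)
    moreover have "(?R - ?x) * 3 \<le> (?R - ?x) * (?R + ?x)"
      using R3 by (intro mult_left_mono) (auto simp: abs_Re_le_cmod)
    ultimately have d: "0 \<le> ?R - ?x" "?R - ?x \<le> 1/3" by auto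
    have c: "cos (2 * (?R - ?x)) \<ge> 0"
      using d pi_gt3 by (intro cos_ge_zero) auto
    have "cos (2 * Re z) = cos (2 * ?x)" by (simp add: abs_if)
    also have "2 * ?x = 2 * ?R - 2 * (?R - ?x)" by simp
    also have "cos \<dots> = cos (2 * ?R) * cos (2 * (?R - ?x)) + sin (2 * ?R) * sin (2 * (?R - ?x))"
      by (rule cos_diff)
    \<comment> \<open>Twice the radius is an odd multiple of pi, which turns the cosine into minus
      the cosine of the small angle.\<close>
    also have "2 * ?R = pi + 2 * real N * pi" by (simp add: R algebra_simps)
    also have "cos \<dots> = -1"
      by (metis cos_periodic_pi2 cos_2npi)
    also have "sin (pi + 2 * real N * pi) = 0"
      by (metis sin_periodic_pi2 sin_2npi neg_0_equal_iff_equal)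
    finally have "cos (2 * Re z) \<le> 0" using c by simp
    moreover have "exp (2 * y) / 4 \<le> exp (2 * y)" by simp
    ultimately show ?thesis using exp_gt_zero[of "-(2 * y)"] unfolding exp_minus by linarith
  qed
  with eq have "exp (2 * y) \<le> 16 * (cmod (sin z))\<^sup>2" by simp
  then have "(exp y)\<^sup>2 \<le> (4 * cmod (sin z))\<^sup>2"
    by (simp add: exp_double power_mult_distrib)
  then show ?thesis unfolding y_def by (rule power2_le_imp_le) simp
qed

subsection \<open>Cardinal series of vector-valued entire functions\<close>

text \<open>Interpreting complex scalar multiplication as a bounded bilinear map makes the general
  facts on sums, continuity and uniform limits of products available for it.\<close>

lemma bounded_bilinear_scaleC:
  "bounded_bilinear (scaleC :: complex \<Rightarrow> 'a::complex_banach \<Rightarrow> 'a)"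
proof
  fix r :: real and c :: complex and x :: 'a
  show "(r *\<^sub>R c) *\<^sub>C x = r *\<^sub>R c *\<^sub>C x"
    by (simp only: scaleR_conv_of_real scaleC_scaleC[symmetric] scaleC_of_real)
  show "c *\<^sub>C r *\<^sub>R x = r *\<^sub>R c *\<^sub>C x"
    by (simp only: scaleC_of_real[symmetric] scaleC_scaleC mult.commute)
  show "\<exists>K. \<forall>(a::complex) (b::'a). norm (a *\<^sub>C b) \<le> norm a * norm b * K"
    by (rule exI[of _ 1]) (simp add: norm_scaleC)
qed (simp_all add: scaleC_add_right scaleC_add_left)

interpretation scaleC: bounded_bilinear "scaleC :: complex \<Rightarrow> 'a::complex_banach \<Rightarrow> 'a"
  by (rule bounded_bilinear_scaleC)

text \<open>\<open>J\<close> is the vector-valued contour integral of \<open>\<phi> z *\<^sub>C H z\<close> along the circle.\<close>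
lemma contour_integral_power_series:
  fixes b :: "nat \<Rightarrow> 'a::complex_banach" and H :: "complex \<Rightarrow> 'a"
  assumes H: "\<And>z. (\<lambda>n. z ^ n *\<^sub>C b n) sums H z"
    and b: "summable (\<lambda>n. r ^ n * norm (b n))"
    and r: "0 \<le> r"
    and \<phi>: "continuous_on (sphere 0 r) \<phi>"
    and B: "\<And>z. cmod z = r \<Longrightarrow> norm (\<phi> z *\<^sub>C H z) \<le> B"
  obtains J where "(\<lambda>n. contour_integral (circlepath 0 r) (\<lambda>z. z ^ n * \<phi> z) *\<^sub>C b n) sums J"
    "norm J \<le> 2 * pi * r * B"
proof -
  define \<gamma> where "\<gamma> = circlepath 0 r"
  define \<gamma>' where "\<gamma>' s = vector_derivative \<gamma> (at s)" for s
  have in_sphere: "\<gamma> s \<in> sphere 0 r" for s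
    using r by (simp add: \<gamma>_def circlepath norm_mult)
  have cont_\<gamma>: "continuous_on {0..1} \<gamma>"
    unfolding \<gamma>_def circlepath by (intro continuous_intros)
  have cont_\<gamma>': "continuous_on {0..1} \<gamma>'"
    unfolding \<gamma>'_def \<gamma>_def vector_derivative_circlepath by (intro continuous_intros)
  have norm_\<gamma>': "cmod (\<gamma>' s) = 2 * pi * r" for s
    using r by (simp add: \<gamma>'_def \<gamma>_def vector_derivative_circlepath norm_mult)
  have cont_\<phi>: "continuous_on {0..1} (\<lambda>s. \<phi> (\<gamma> s))"
    by (rule continuous_on_compose2[OF \<phi> cont_\<gamma>]) (use in_sphere in blast)
  define F where "F m s = (\<phi> (\<gamma> s) * \<gamma>' s) *\<^sub>C (\<Sum>n<m. \<gamma> s ^ n *\<^sub>C b n)" for m s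
  define F' where "F' s = (\<phi> (\<gamma> s) * \<gamma>' s) *\<^sub>C H (\<gamma> s)" for s
  \<comment> \<open>The terms \<open>r ^ n * norm (b n)\<close> majorize the series on the whole
    circle. The resulting uniform convergence permits integrating term by term.\<close>
  have ul: "uniform_limit {0..1} (\<lambda>m s. \<Sum>n<m. \<gamma> s ^ n *\<^sub>C b n) (\<lambda>s. H (\<gamma> s)) sequentially"
  proof -
    have "uniform_limit {0..1} (\<lambda>m s. \<Sum>n<m. \<gamma> s ^ n *\<^sub>C b n) (\<lambda>s. suminf (\<lambda>n. \<gamma> s ^ n *\<^sub>C b n)) sequentially"
      using in_sphere b by (intro Weierstrass_m_test) (auto simp: norm_scaleC norm_power)
    then show ?thesis using H by (simp add: sums_iff)
  qed
  have "bounded ((\<lambda>s. \<phi> (\<gamma> s) * \<gamma>' s) ` {0..1})"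
    by (intro compact_imp_bounded compact_continuous_image continuous_intros cont_\<phi> cont_\<gamma>') auto
  moreover have "bounded ((\<lambda>s. H (\<gamma> s)) ` {0..1})"
  proof -
    have "continuous_on {0..1} (\<lambda>s. H (\<gamma> s))"
      by (rule uniform_limit_theorem[OF _ ul])
        (auto intro!: always_eventually continuous_intros scaleC.continuous_on cont_\<gamma>)
    then show ?thesis by (intro compact_imp_bounded compact_continuous_image) auto
  qed
  ultimately have "uniform_limit {0..1} F F' sequentially"
    unfolding F_def F'_def
    by (intro scaleC.bounded_uniform_limit uniform_limit_const ul)
  moreover have "continuous_on {0..1} (F m)" for m
    unfolding F_def by (intro scaleC.continuous_on continuous_intros cont_\<gamma> cont_\<phi> cont_\<gamma>')
  ultimately obtain I J where I: "\<And>m. (F m has_integral I m) {0..1}"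
    and J: "(F' has_integral J) {0..1}" and lim: "I \<longlonglongrightarrow> J"
    by (rule uniform_limit_integral) auto
  have I_eq: "I m = (\<Sum>n<m. contour_integral \<gamma> (\<lambda>z. z ^ n * \<phi> z) *\<^sub>C b n)" for m
  proof -
    have "((\<lambda>s. \<Sum>n<m. (\<gamma> s ^ n * \<phi> (\<gamma> s) * \<gamma>' s) *\<^sub>C b n) has_integral
          (\<Sum>n<m. contour_integral \<gamma> (\<lambda>z. z ^ n * \<phi> z) *\<^sub>C b n)) {0..1}"
    proof (intro has_integral_sum)
      fix n
      have "((\<lambda>s. \<gamma> s ^ n * \<phi> (\<gamma> s) * \<gamma>' s) has_integral contour_integral \<gamma> (\<lambda>z. z ^ n * \<phi> z)) {0..1}"
        unfolding contour_integral_integral \<gamma>'_def[symmetric]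
        by (intro integrable_integral integrable_continuous_real continuous_intros cont_\<gamma> cont_\<phi> cont_\<gamma>')
      then show "((\<lambda>s. (\<gamma> s ^ n * \<phi> (\<gamma> s) * \<gamma>' s) *\<^sub>C b n) has_integral
          contour_integral \<gamma> (\<lambda>z. z ^ n * \<phi> z) *\<^sub>C b n) {0..1}"
        using has_integral_linear[OF _ scaleC.bounded_linear_left] by (auto simp: o_def)
    qed auto
    moreover have "F m = (\<lambda>s. \<Sum>n<m. (\<gamma> s ^ n * \<phi> (\<gamma> s) * \<gamma>' s) *\<^sub>C b n)"
      unfolding F_def scaleC.sum_right scaleC_scaleC by (simp add: mult_ac)
    ultimately have "(F m has_integral (\<Sum>n<m. contour_integral \<gamma> (\<lambda>z. z ^ n * \<phi> z) *\<^sub>C b n)) {0..1}"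
      by simp
    then show ?thesis
      by (rule has_integral_unique[OF I[of m]])
  qed
  have "norm J \<le> 2 * pi * r * B"
  proof -
    have "norm (\<phi> (\<gamma> 0) *\<^sub>C H (\<gamma> 0)) \<le> B" using B[of "\<gamma> 0"] in_sphere[of 0] by simp
    then have "0 \<le> B" by (rule order_trans[OF norm_ge_zero])
    moreover have "norm (F' s) \<le> 2 * pi * r * B" for s
    proof -
      have "norm (F' s) = cmod (\<gamma>' s) * norm (\<phi> (\<gamma> s) *\<^sub>C H (\<gamma> s))"
        by (simp add: F'_def norm_scaleC norm_mult)
      also have "\<dots> \<le> 2 * pi * r * B"
        unfolding norm_\<gamma>' using r B[of "\<gamma> s"] in_sphere[of s] by (intro mult_left_mono) auto
      finally show ?thesis .
    qed
    ultimately show ?thesis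
      using has_integral_bound[of "2 * pi * r * B" F' J 0 1] J r by (simp add: cbox_interval)
  qed
  moreover have "(\<lambda>n. contour_integral (circlepath 0 r) (\<lambda>z. z ^ n * \<phi> z) *\<^sub>C b n) sums J"
    using lim unfolding sums_def I_eq[abs_def] \<gamma>_def .
  ultimately show ?thesis using that by blast
qed

text \<open>By residues the integral of the kernel times \<open>H\<close> is 2 pi i / sin x times
  the error \<open>H x - S N\<close>. On the circle the growth of \<open>H\<close> cancels against
  that of the sine, and the factor \<open>z\<close> in the hypothesis \<open>K\<close> supplies a
  decay 1/R that compensates the length of the circle. What remains is of order 1/(R - |x|).\<close>

lemma sampling_symmetric_partial_sums:
  fixes b :: "nat \<Rightarrow> 'a::complex_banach" and H :: "complex \<Rightarrow> 'a" and x :: real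
  assumes H: "\<And>z. (\<lambda>n. z ^ n *\<^sub>C b n) sums H z"
    and b: "\<And>r. 0 \<le> r \<Longrightarrow> summable (\<lambda>n. r ^ n * norm (b n))"
    and K: "\<And>z. norm (z *\<^sub>C H z) \<le> K * exp \<bar>Im z\<bar>"
    and sinx: "sin x \<noteq> 0"
  shows "(\<lambda>N. \<Sum>k=-int N..int N. (sin x / ((x - k * pi) * cos (k * pi))) *\<^sub>R H (of_real (k * pi))) \<longlonglongrightarrow> H (of_real x)"
proof -
  define S where "S N = (\<Sum>k=-int N..int N. (sin x / ((x - k * pi) * cos (k * pi))) *\<^sub>R H (of_real (k * pi)))" for N
  define R where "R N = (real N + 1/2) * pi" for N
  have K0: "0 \<le> K" using K[of 0] by (simp add: scaleC.zero_left)
  have bound: "norm (S N - H (of_real x)) \<le> 4 * K * \<bar>sin x\<bar> / (R N - \<bar>x\<bar>)"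
    if N: "N \<ge> 1" "\<bar>x\<bar> < R N" for N
  proof -
    define \<phi> where "\<phi> z = 1 / ((z - complex_of_real x) * sin z)" for z
    have nz: "sin z \<noteq> 0" "z \<noteq> of_real x" if "cmod z = R N" for z
      using that N by (auto simp: R_def circle_half_odd_avoids_sin_zeros)
    have "(R N) \<ge> 0" by (simp add: R_def)
    have RN: "R N > 0" using N by linarith
    obtain J where J: "(\<lambda>n. contour_integral (circlepath 0 (R N)) (\<lambda>z. z ^ n * \<phi> z) *\<^sub>C b n) sums J"
      and nJ: "norm J \<le> 2 * pi * R N * (4 * K / (R N * (R N - \<bar>x\<bar>)))"
    proof (rule contour_integral_power_series[OF H, of "R N" \<phi> "4 * K / (R N * (R N - \<bar>x\<bar>))"])
      show "summable (\<lambda>n. R N ^ n * norm (b n))" "0 \<le> R N" by (auto intro: b \<open>R N \<ge> 0\<close>)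
      show "continuous_on (sphere 0 (R N)) \<phi>"
        unfolding \<phi>_def using nz by (intro continuous_intros) auto
      fix z assume z: "cmod z = R N"
      have d: "R N - \<bar>x\<bar> \<le> cmod (z - of_real x)"
        using norm_triangle_ineq2[of z "of_real x"] z by simp
      have s: "exp \<bar>Im z\<bar> \<le> 4 * cmod (sin z)"
        using z N by (intro norm_sin_ge_on_circle[of z N]) (auto simp: R_def)
      have "R N * norm (H z) \<le> K * exp \<bar>Im z\<bar>" using K[of z] z by (simp add: norm_scaleC)
      also have "\<dots> \<le> K * (4 * cmod (sin z))" using s K0 by (rule mult_left_mono)
      finally have h: "norm (H z) \<le> 4 * K * cmod (sin z) / R N" using RN by (simp add: field_simps)
      have "norm (\<phi> z *\<^sub>C H z) = norm (H z) / (cmod (z - of_real x) * cmod (sin z))"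
        by (simp add: \<phi>_def norm_scaleC norm_divide norm_mult)
      also have "\<dots> \<le> (4 * K * cmod (sin z) / R N) / ((R N - \<bar>x\<bar>) * cmod (sin z))"
        using h d N nz[OF z] K0 RN by (intro frac_le mult_right_mono mult_pos_pos) auto
      also have "\<dots> = 4 * K / (R N * (R N - \<bar>x\<bar>))"
        using nz[OF z] by simp
      finally show "norm (\<phi> z *\<^sub>C H z) \<le> 4 * K / (R N * (R N - \<bar>x\<bar>))" .
    qed
    define c where "c = 2 * pi * \<i>"
    define w where "w k = 1 / ((k * pi - x) * cos (k * pi))" for k :: int
    \<comment> \<open>The scalar residue formula is applied to each coefficient; summing over
      \<open>n\<close> then reassembles the values of \<open>H\<close> at \<open>x\<close> and at
      the nodes.\<close>
    have ci: "contour_integral (circlepath 0 (R N)) (\<lambda>z. z ^ n * \<phi> z) *\<^sub>C b n =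
        c *\<^sub>C ((1 / sin x) *\<^sub>R (of_real x ^ n *\<^sub>C b n) +
          (\<Sum>k=-int N..int N. w k *\<^sub>R (of_real (k * pi) ^ n *\<^sub>C b n)))" for n
    proof -
      have "contour_integral (circlepath 0 (R N)) (\<lambda>z. z ^ n * \<phi> z)
          = c * of_real (x ^ n / sin x + (\<Sum>k=-int N..int N. (k * pi) ^ n / ((k * pi - x) * cos (k * pi))))"
        using contour_integral_sampling_kernel[OF sinx, of N n] N by (simp add: \<phi>_def R_def c_def)
      also have "\<dots> *\<^sub>C b n = c *\<^sub>C (x ^ n / sin x + (\<Sum>k=-int N..int N. (k * pi) ^ n / ((k * pi - x) * cos (k * pi)))) *\<^sub>R b n"
        by (simp only: scaleC_scaleC[symmetric] scaleC_of_real)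
      finally show ?thesis
        by (simp add: scaleR_add_left scaleR_sum_left w_def scaleC_of_real del: of_real_mult flip: of_real_power)
    qed
    have "(\<lambda>n. c *\<^sub>C ((1 / sin x) *\<^sub>R (of_real x ^ n *\<^sub>C b n) +
          (\<Sum>k=-int N..int N. w k *\<^sub>R (of_real (k * pi) ^ n *\<^sub>C b n))))
        sums (c *\<^sub>C ((1 / sin x) *\<^sub>R H (of_real x) + (\<Sum>k=-int N..int N. w k *\<^sub>R H (of_real (k * pi)))))"
      by (intro bounded_linear.sums[OF scaleC.bounded_linear_right] sums_add sums_sum
          bounded_linear.sums[OF bounded_linear_scaleR_right] H)
    then have J_eq: "J = c *\<^sub>C ((1 / sin x) *\<^sub>R H (of_real x) + (\<Sum>k=-int N..int N. w k *\<^sub>R H (of_real (k * pi))))"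
      using J unfolding ci by (rule sums_unique2[symmetric])
    \<comment> \<open>The residues carry \<open>k * pi - x\<close>, the cardinal series
      \<open>x - k * pi\<close>. This sign is what makes \<open>J\<close> a difference.\<close>
    have "(\<Sum>k=-int N..int N. w k *\<^sub>R H (of_real (k * pi))) = - (1 / sin x) *\<^sub>R S N"
    proof -
      have "w k = - (1 / sin x) * (sin x / ((x - k * pi) * cos (k * pi)))" for k
      proof -
        have eq: "(k * pi - x) * cos (k * pi) = - ((x - k * pi) * cos (k * pi))"
          by (simp add: algebra_simps)
        show ?thesis unfolding w_def eq using sinx by simp
      qed
      then show ?thesis by (simp add: S_def scaleR_sum_right)
    qed
    then have "J = c *\<^sub>C (1 / sin x) *\<^sub>R (H (of_real x) - S N)"
      using J_eq by (simp add: scaleR_diff_right)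
    then have "norm J = 2 * pi * (norm (S N - H (of_real x)) / \<bar>sin x\<bar>)"
      by (simp add: norm_scaleC c_def norm_mult norm_minus_commute)
    with nJ have "2 * pi * (norm (S N - H (of_real x)) / \<bar>sin x\<bar>) \<le> 2 * pi * (R N * (4 * K / (R N * (R N - \<bar>x\<bar>))))"
      by (simp only: mult.assoc)
    then have "norm (S N - H (of_real x)) / \<bar>sin x\<bar> \<le> R N * (4 * K / (R N * (R N - \<bar>x\<bar>)))"
      by (rule mult_left_le_imp_le) simp
    also have "\<dots> = 4 * K / (R N - \<bar>x\<bar>)" using RN by simp
    finally show ?thesis using sinx by (simp add: pos_divide_le_eq)
  qed
  have Rlim: "filterlim (\<lambda>N. R N - \<bar>x\<bar>) at_top sequentially"
  proof (rule filterlim_at_top_mono)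
    show "filterlim (\<lambda>N. - \<bar>x\<bar> + real N) at_top sequentially"
      by (intro filterlim_tendsto_add_at_top[OF tendsto_const] filterlim_real_sequentially)
    have "real N * 1 \<le> R N" for N
      unfolding R_def using pi_gt3 by (intro mult_mono) auto
    then show "\<forall>\<^sub>F N in sequentially. - \<bar>x\<bar> + real N \<le> R N - \<bar>x\<bar>"
      by (auto intro!: always_eventually)
  qed
  have "\<forall>\<^sub>F N in sequentially. norm (S N - H (of_real x)) \<le> 4 * K * \<bar>sin x\<bar> / (R N - \<bar>x\<bar>)"
    using eventually_ge_at_top[of 1] filterlim_at_top_dense[THEN iffD1, OF Rlim, rule_format, of 0]
    by eventually_elim (use bound in auto)
  moreover have "(\<lambda>N. 4 * K * \<bar>sin x\<bar> / (R N - \<bar>x\<bar>)) \<longlonglongrightarrow> 0"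
    by (intro tendsto_divide_0[OF tendsto_const] filterlim_at_top_imp_at_infinity Rlim)
  ultimately have "(\<lambda>N. S N - H (of_real x)) \<longlonglongrightarrow> 0"
    by (rule Lim_null_comparison)
  then show ?thesis unfolding S_def by (rule LIM_zero_cancel)
qed

subsection \<open>Entire extension of orbits\<close>

text \<open>The integral form of the remainder is bounded by M t t^p / p!, which tends to 0 because
  all derivatives share the bound \<open>M\<close>.\<close>

lemma Taylor_sums_nonneg:
  fixes F :: "nat \<Rightarrow> real \<Rightarrow> 'a::banach"
  assumes F: "\<And>m s. (F m has_vector_derivative F (Suc m) s) (at s)"
    and M: "\<And>m s. norm (F m s) \<le> M" and t: "0 \<le> t"
  shows "(\<lambda>n. (t ^ n / fact n) *\<^sub>R F n 0) sums F 0 t"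
proof -
  \<comment> \<open>The exponent \<open>Suc p - 1\<close> keeps the shape of the integral remainder
    rule for order \<open>Suc p\<close>, which is positive as that rule requires.\<close>
  define r where "r p s = ((t - s) ^ (Suc p - 1) / fact (Suc p - 1)) *\<^sub>R F (Suc p) s" for p s
  have bound: "norm (F 0 t - (\<Sum>i<Suc p. (t ^ i / fact i) *\<^sub>R F i 0)) \<le> M * t * (inverse (fact p) * t ^ p)" for p
  proof -
    have "(r p has_integral F 0 t - (\<Sum>i<Suc p. ((t - 0) ^ i / fact i) *\<^sub>R F i 0)) {0..t}"
      unfolding r_def
      by (rule Taylor_has_integral) (use t in \<open>auto intro: F has_vector_derivative_at_within\<close>)
    then have I: "(r p has_integral F 0 t - (\<Sum>i<Suc p. (t ^ i / fact i) *\<^sub>R F i 0)) (cbox 0 t)"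
      by (simp add: cbox_interval)
    have M0: "0 \<le> M" using M[of 0 0] norm_ge_zero order_trans by blast
    have "norm (r p s) \<le> (t ^ p / fact p) * M" if s: "s \<in> cbox 0 t" for s
    proof -
      have "norm (r p s) = (t - s) ^ p / fact p * norm (F (Suc p) s)"
        using s by (simp add: r_def)
      also have "\<dots> \<le> (t ^ p / fact p) * M"
        using s M by (intro mult_mono divide_right_mono power_mono) auto
      finally show ?thesis .
    qed
    with I have "norm (F 0 t - (\<Sum>i<Suc p. (t ^ i / fact i) *\<^sub>R F i 0)) \<le> (t ^ p / fact p) * M * measure lborel (cbox 0 t)"
      by (intro has_integral_bound) (use t M0 in auto)
    then show ?thesis using t by (simp add: field_simps)
  qed
  have "(\<lambda>p. M * t * (inverse (fact p) * t ^ p)) \<longlonglongrightarrow> 0"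
    using tendsto_mult_right_zero[OF summable_LIMSEQ_zero[OF summable_exp[of t]]] by simp
  then have "(\<lambda>p. (\<Sum>i<Suc p. (t ^ i / fact i) *\<^sub>R F i 0) - F 0 t) \<longlonglongrightarrow> 0"
    by (rule Lim_null_comparison[rotated])
      (intro always_eventually allI, subst norm_minus_commute, rule bound)
  then have "(\<lambda>p. \<Sum>i<Suc p. (t ^ i / fact i) *\<^sub>R F i 0) \<longlonglongrightarrow> F 0 t"
    by (rule LIM_zero_cancel)
  then show ?thesis
    unfolding sums_def by (rule LIMSEQ_imp_Suc)
qed

text \<open>For negative \<open>t\<close> the line is reflected; the signs \<open>(-1) ^ m\<close>
  make the reflected functions a chain of derivatives again and cancel in the series.\<close>

lemma Taylor_sums:
  fixes F :: "nat \<Rightarrow> real \<Rightarrow> 'a::banach"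
  assumes F: "\<And>m s. (F m has_vector_derivative F (Suc m) s) (at s)"
    and M: "\<And>m s. norm (F m s) \<le> M"
  shows "(\<lambda>n. (t ^ n / fact n) *\<^sub>R F n 0) sums F 0 t"
proof (cases "0 \<le> t")
  case True
  with F M show ?thesis by (rule Taylor_sums_nonneg)
next
  case False
  define F' where "F' m s = (-1) ^ m *\<^sub>R F m (- s)" for m s
  have "(F' m has_vector_derivative F' (Suc m) s) (at s)" for m s
  proof -
    have "((F m \<circ> uminus) has_vector_derivative (-1) *\<^sub>R F (Suc m) (- s)) (at s)"
      by (rule vector_diff_chain_at) (auto intro!: derivative_eq_intros F)
    from has_vector_derivative_scaleR[OF DERIV_const this, of "(-1) ^ m"]
    show ?thesis by (simp add: F'_def[abs_def] o_def)
  qed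
  moreover have "norm (F' m s) \<le> M" for m s using M by (simp add: F'_def)
  ultimately have "(\<lambda>n. ((- t) ^ n / fact n) *\<^sub>R F' n 0) sums F' 0 (- t)"
    using False by (intro Taylor_sums_nonneg) auto
  moreover have "((- t) ^ n / fact n) *\<^sub>R F' n 0 = (t ^ n / fact n) *\<^sub>R F n 0" for n
    by (simp add: F'_def flip: power_mult_distrib)
  ultimately have "(\<lambda>n. (t ^ n / fact n) *\<^sub>R F n 0) sums F' 0 (- t)"
    by (simp only:)
  then show ?thesis by (simp add: F'_def)
qed

context isometry_group
begin

lemma linear: "linear (U t)"
proof
  show "U t (r *\<^sub>R x) = r *\<^sub>R U t x" for r x
    using scaleC[of t "of_real r" x] by (simp add: scaleC_of_real)
qed (rule add)

lemma bounded_linear: "bounded_linear (U t)"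
  by (intro bounded_linear_intro[where K=1]) (simp_all add: linear_add[OF linear] linear_scale[OF linear] norm)

text \<open>The sequence \<open>a\<close> plays the role of the vectors D^m f. Estimating the power
  series termwise would only give exp |z|. Splitting z = x + iy into a double series lets the powers
  of x sum to the isometry \<open>U x\<close>, so that only |Im z| enters the bound.\<close>

lemma has_sum_orbit:
  fixes a :: "nat \<Rightarrow> 'a" and z :: complex
  assumes a: "\<And>m s. ((\<lambda>s. U s (a m)) has_vector_derivative U s (a (Suc m))) (at s)"
    and M: "\<And>m. norm (a m) \<le> M"
  shows "\<exists>S. ((\<lambda>n. (z ^ n / fact n) *\<^sub>C a n) has_sum S) UNIV \<and> norm S \<le> M * exp \<bar>Im z\<bar>"
proof -
  define x y where "x = Re z" and "y = Im z"
  define c where "c m = (\<i> * of_real y) ^ m / fact m" for m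
  define f where "f = (\<lambda>(m, n). (c m * of_real (x ^ n / fact n)) *\<^sub>C a (m + n))"
  have exp_sums: "(\<lambda>n. \<bar>s\<bar> ^ n / fact n) sums exp \<bar>s\<bar>" for s :: real
    using exp_converges[of "\<bar>s\<bar>"] by (simp add: field_simps)
  then have exp_has_sum: "((\<lambda>n. \<bar>s\<bar> ^ n / fact n) has_sum exp \<bar>s\<bar>) UNIV" for s :: real
    by (rule sums_nonneg_imp_has_sum) auto
  have cn: "cmod (c m) = \<bar>y\<bar> ^ m / fact m" for m
    by (simp add: c_def norm_divide norm_power norm_mult)
  have fn: "norm (f (m, n)) \<le> (\<bar>y\<bar> ^ m / fact m * M) * (\<bar>x\<bar> ^ n / fact n)" for m n
  proof -
    have "norm (f (m, n)) = \<bar>y\<bar> ^ m / fact m * (\<bar>x\<bar> ^ n / fact n) * norm (a (m + n))"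
      by (simp add: f_def norm_scaleC norm_mult cn norm_divide norm_power power_abs)
    also have "\<dots> \<le> \<bar>y\<bar> ^ m / fact m * (\<bar>x\<bar> ^ n / fact n) * M"
      using M by (intro mult_left_mono) auto
    finally show ?thesis by (simp add: mult_ac)
  qed
  have M0: "0 \<le> M" using M[of 0] norm_ge_zero order_trans by blast
  \<comment> \<open>The product of two exponential series dominates the double series; absolute
    summability justifies both rearrangements.\<close>
  have "(\<lambda>p. norm (f p)) summable_on UNIV \<times> UNIV"
  proof (rule Infinite_Sum.abs_summable_on_comparison_test')
    show "(\<lambda>(m, n). (\<bar>y\<bar> ^ m / fact m * M) * (\<bar>x\<bar> ^ n / fact n)) summable_on UNIV \<times> UNIV"
    proof (rule summable_on_SigmaI)
      show "((\<lambda>n. case (m, n) of (m, n) \<Rightarrow> (\<bar>y\<bar> ^ m / fact m * M) * (\<bar>x\<bar> ^ n / fact n)) has_sum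
          (\<bar>y\<bar> ^ m / fact m * M) * exp \<bar>x\<bar>) UNIV" for m
        unfolding prod.case by (intro has_sum_cmult_right exp_has_sum)
      show "(\<lambda>m. (\<bar>y\<bar> ^ m / fact m * M) * exp \<bar>x\<bar>) summable_on UNIV"
        using exp_has_sum by (intro summable_on_cmult_left) (rule has_sum_imp_summable)
    qed (use M0 in auto)
  qed (use fn in auto)
  then obtain S where S: "(f has_sum S) (UNIV \<times> UNIV)"
    using Infinite_Sum.abs_summable_summable has_sum_infsum by blast
  have row: "((\<lambda>n. f (m, n)) has_sum c m *\<^sub>C U x (a m)) UNIV" for m
  proof -
    have "(\<lambda>n. (x ^ n / fact n) *\<^sub>R U 0 (a (m + n))) sums U x (a (m + 0))"
      by (rule Taylor_sums[where F = "\<lambda>n s. U s (a (m + n))" and M = M])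
        (use a in \<open>simp_all add: norm M\<close>)
    moreover have "summable (\<lambda>n. norm ((x ^ n / fact n) *\<^sub>R U 0 (a (m + n))))"
    proof (rule summable_comparison_test')
      show "summable (\<lambda>n. \<bar>x\<bar> ^ n / fact n * M)"
        using exp_sums by (intro summable_mult2) (rule sums_summable)
      show "norm (norm ((x ^ n / fact n) *\<^sub>R U 0 (a (m + n)))) \<le> \<bar>x\<bar> ^ n / fact n * M" if "n \<ge> 0" for n
        using M[of "m + n"] by (simp add: norm power_abs divide_right_mono mult_left_mono)
    qed
    ultimately have "((\<lambda>n. (x ^ n / fact n) *\<^sub>R a (m + n)) has_sum U x (a m)) UNIV"
      unfolding zero add_0_right by (intro norm_summable_imp_has_sum)
    from has_sum_bounded_linear[OF scaleC.bounded_linear_right[of "c m"] this]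
    show ?thesis by (simp only: f_def prod.case scaleC_of_real[symmetric] scaleC_scaleC)
  qed
  text \<open>Summing by rows bounds the sum, as each row is \<open>c m\<close> times an orbit point; summing along
    the diagonals gives the power series.\<close>
  have rows: "((\<lambda>m. c m *\<^sub>C U x (a m)) has_sum S) UNIV"
    using has_sum_SigmaD[OF S row] by simp
  have "norm S \<le> M * exp \<bar>y\<bar>"
  proof (rule norm_infsum_le[OF rows])
    show "((\<lambda>m. M * (\<bar>y\<bar> ^ m / fact m)) has_sum M * exp \<bar>y\<bar>) UNIV"
      by (intro has_sum_cmult_right exp_has_sum)
    show "norm (c m *\<^sub>C U x (a m)) \<le> M * (\<bar>y\<bar> ^ m / fact m)" for m
      using mult_right_mono[OF M, of "cmod (c m)" m] by (simp add: norm_scaleC norm cn mult.commute)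
  qed
  \<comment> \<open>The pairs (m, n) are regrouped by p = m + n, with k = m as position on the
    diagonal; the binomial theorem then evaluates each diagonal.\<close>
  have "((\<lambda>(p, k). f (k, p - k)) has_sum S) (SIGMA p:UNIV. {..p})"
    using S
    by (subst has_sum_reindex_bij_witness[where S = "SIGMA p:UNIV. {..p}" and T = "UNIV \<times> UNIV"
        and i = "\<lambda>(m, n). (m + n, m)" and j = "\<lambda>(p, k). (k, p - k)"]) auto
  then have "((\<lambda>p. \<Sum>k\<le>p. f (k, p - k)) has_sum S) UNIV"
    by (rule has_sum_SigmaD) (auto intro: has_sum_finiteI)
  moreover have "(\<Sum>k\<le>p. f (k, p - k)) = (z ^ p / fact p) *\<^sub>C a p" for p
  proof -
    have "z = \<i> * of_real y + of_real x"
      by (simp add: x_def y_def complex_eq_iff)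
    then have "z ^ p / fact p = (\<Sum>k\<le>p. of_nat (p choose k) * (\<i> * of_real y) ^ k * of_real x ^ (p - k)) / fact p"
      by (simp only: binomial_ring)
    also have "\<dots> = (\<Sum>k\<le>p. c k * of_real (x ^ (p - k) / fact (p - k)))"
      unfolding sum_divide_distrib c_def
      by (intro sum.cong refl) (simp add: binomial_fact field_simps)
    finally show ?thesis
      by (simp add: f_def scaleC.sum_left)
  qed
  ultimately show ?thesis
    using \<open>norm S \<le> M * exp \<bar>y\<bar>\<close> unfolding y_def by auto
qed

end

subsection \<open>Sums of sinc functions\<close>

lemma sinc_minus: "sinc (- x) = sinc x"
  by (simp add: sinc_def)

text \<open>The bound combines |sinc x| \<le> 1 for |x| \<le> 1 with |sinc x| \<le> 1/|x| elsewhere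
  in a form free of singularities, ready for summation over integer shifts.\<close>

lemma sinc_square_le: "(sinc x)\<^sup>2 \<le> 2 / (1 + x\<^sup>2)"
proof (cases "\<bar>x\<bar> \<le> 1")
  case True
  then have "x\<^sup>2 \<le> 1" by (simp add: abs_square_le_1)
  then have "1 \<le> 2 / (1 + x\<^sup>2)" by (simp add: field_simps add_pos_nonneg)
  moreover have "\<bar>sinc x\<bar> \<le> 1"
  proof (cases "x = 0")
    case False
    then show ?thesis using abs_sin_le_one abs_sin_x_le_abs_x[of "pi * x"]
      by (simp add: sinc_def abs_mult)
  qed (simp add: sinc_def)
  then have "(sinc x)\<^sup>2 \<le> 1" by (simp add: abs_square_le_1)
  ultimately show ?thesis by linarith
next
  case False
  then have x: "x\<^sup>2 > 1" using abs_square_le_1[of x] by linarith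
  have "\<bar>sin (pi * x)\<bar> / \<bar>pi * x\<bar> \<le> 1 / \<bar>x\<bar>"
    using False pi_gt3 mult_mono[of 1 pi "\<bar>x\<bar>" "\<bar>x\<bar>"]
    by (intro frac_le) (auto simp: abs_mult)
  then have "\<bar>sinc x\<bar> \<le> 1 / \<bar>x\<bar>" using False by (auto simp: sinc_def)
  then have "(sinc x)\<^sup>2 \<le> 1 / x\<^sup>2"
    using power_mono[of "\<bar>sinc x\<bar>" "1 / \<bar>x\<bar>" 2] by (simp add: power_divide)
  also have "\<dots> = 2 / (x\<^sup>2 + x\<^sup>2)" by simp
  also have "\<dots> \<le> 2 / (1 + x\<^sup>2)" using x by (intro divide_left_mono mult_pos_pos) auto
  finally show ?thesis .
qed

lemma summable_on_inverse_1_plus_int_square: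
  "(\<lambda>k::int. 1 / (1 + (real_of_int k)\<^sup>2)) summable_on A"
proof -
  let ?w = "\<lambda>k::int. 1 / (1 + (real_of_int k)\<^sup>2)"
  have "summable (\<lambda>n. 1 / (1 + (real n)\<^sup>2))"
  proof (rule summable_comparison_test')
    show "summable (\<lambda>n. 1 / (real n)\<^sup>2)"
      using inverse_power_summable[of 2, where 'a = real] by (simp add: field_simps)
    show "norm (1 / (1 + (real n)\<^sup>2)) \<le> 1 / (real n)\<^sup>2" if "n \<ge> 1" for n
      using that by (simp add: frac_le add_pos_nonneg)
  qed
  then have nat: "(\<lambda>n. 1 / (1 + (real n)\<^sup>2)) summable_on UNIV"
    by (subst summable_on_UNIV_nonneg_real_iff) auto
  have "?w summable_on range int" "?w summable_on range (\<lambda>n. - int n)"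
    by (subst summable_on_reindex; use nat in \<open>simp add: o_def inj_on_def\<close>)+
  then have "?w summable_on range int \<union> range (\<lambda>n. - int n)"
    by (rule summable_on_union)
  also have "range int \<union> range (\<lambda>n. - int n) = UNIV"
  proof (intro equalityI subset_UNIV subsetI)
    fix k :: int
    show "k \<in> range int \<union> range (\<lambda>n. - int n)"
      by (cases k rule: int_cases2) auto
  qed
  finally show ?thesis by (rule summable_on_subset) simp
qed

text \<open>Uniformity in \<open>x\<close> comes from recentring the index at j = floor x. With s =
  x - k one has |k - j| \<le> |s| + 1, hence 1 + (k - j)^2 \<le> 3 (1 + s^2); together with the 2 of
  \<open>sinc_square_le\<close> this gives the constant 6.\<close>

lemma sum_sinc_square_bounded:
  "\<exists>C\<ge>0. \<forall>F x. finite F \<longrightarrow> (\<Sum>k\<in>F. (sinc (x - of_int k))\<^sup>2) \<le> C"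
proof (intro exI conjI allI impI)
  let ?w = "\<lambda>k::int. 1 / (1 + (real_of_int k)\<^sup>2)"
  show "6 * infsum ?w UNIV \<ge> 0" by (simp add: infsum_nonneg)
  fix F :: "int set" and x :: real assume F: "finite F"
  define j y where "j = \<lfloor>x\<rfloor>" and "y = x - of_int j"
  have y: "0 \<le> y" "y < 1" by (auto simp: y_def j_def) linarith
  have "(sinc (x - of_int k))\<^sup>2 \<le> 6 * ?w (k - j)" for k
  proof -
    define s where "s = y - of_int (k - j)"
    have "\<bar>real_of_int (k - j)\<bar> \<le> \<bar>s\<bar> + 1" using y by (auto simp: s_def)
    then have "(real_of_int (k - j))\<^sup>2 \<le> (\<bar>s\<bar> + 1)\<^sup>2" by (metis abs_ge_zero power2_abs power_mono)
    also have "\<dots> \<le> 2 * s\<^sup>2 + 2"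
      using zero_le_power2[of "\<bar>s\<bar> - 1"] by (simp add: power2_eq_square algebra_simps)
    finally have "1 + (real_of_int (k - j))\<^sup>2 \<le> 1 + (2 * s\<^sup>2 + 2)"
      by (rule add_left_mono)
    also have "\<dots> \<le> 3 * (1 + s\<^sup>2)" by simp
    finally have "1 + (real_of_int (k - j))\<^sup>2 \<le> 3 * (1 + s\<^sup>2)" .
    then have "2 / (1 + s\<^sup>2) \<le> 6 * ?w (k - j)"
      by (simp add: divide_simps add_pos_nonneg add_nonneg_eq_0_iff)
    moreover have "x - of_int k = s" by (simp add: s_def y_def)
    ultimately show ?thesis using sinc_square_le[of s] by simp
  qed
  then have "(\<Sum>k\<in>F. (sinc (x - of_int k))\<^sup>2) \<le> (\<Sum>k\<in>F. 6 * ?w (k - j))"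
    by (rule sum_mono)
  also have "\<dots> = 6 * (\<Sum>k\<in>(\<lambda>k. k - j) ` F. ?w k)"
    by (subst sum.reindex) (auto simp: inj_on_def sum_distrib_left)
  also have "\<dots> \<le> 6 * infsum ?w UNIV"
    using F by (intro mult_left_mono finite_sum_le_infsum summable_on_inverse_1_plus_int_square) auto
  finally show "(\<Sum>k\<in>F. (sinc (x - of_int k))\<^sup>2) \<le> 6 * infsum ?w UNIV" .
qed

text \<open>By Cauchy-Schwarz the sum is at most the root of a uniformly bounded sum of squared
  sincs times the root of a tail of the sum of 1/k^2. The set \<open>K\<close> depends on
  \<open>e\<close> alone, not on \<open>x\<close>.\<close>

lemma sum_sinc_over_index_tail:
  assumes "e > 0"
  shows "\<exists>K. finite K \<and> 0 \<notin> K \<and> (\<forall>F x. finite F \<longrightarrow> F \<inter> K = {} \<longrightarrow> 0 \<notin> F \<longrightarrow>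
    (\<Sum>k\<in>F. \<bar>sinc (x - of_int k)\<bar> / \<bar>of_int k\<bar>) \<le> e)"
proof -
  let ?w = "\<lambda>k::int. 1 / (1 + (real_of_int k)\<^sup>2)"
  obtain C where C: "C \<ge> 0" "\<And>F x. finite F \<Longrightarrow> (\<Sum>k\<in>F. (sinc (x - of_int k))\<^sup>2) \<le> C"
    using sum_sinc_square_bounded by blast
  \<comment> \<open>Chosen so that (C + 1) times 2d equals e^2. The factor 2 stems from 1/k^2 \<le>
    2/(1 + k^2), and C + 1 is positive even when C = 0.\<close>
  define d where "d = e\<^sup>2 / (2 * (C + 1))"
  have d: "d > 0" using assms C by (simp add: d_def)
  have "(sum ?w \<longlongrightarrow> infsum ?w (UNIV - {0})) (finite_subsets_at_top (UNIV - {0}))"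
    by (intro infsum_tendsto summable_on_inverse_1_plus_int_square)
  from order_tendstoD(1)[OF this, of "infsum ?w (UNIV - {0}) - d"] d
  obtain K where K: "finite K" "K \<subseteq> UNIV - {0}" "sum ?w K > infsum ?w (UNIV - {0}) - d"
    unfolding eventually_finite_subsets_at_top by auto
  show ?thesis
  proof (intro exI[of _ K] conjI allI impI)
    show "finite K" "0 \<notin> K" using K by auto
    fix F :: "int set" and x :: real assume F: "finite F" "F \<inter> K = {}" "0 \<notin> F"
    have "sum ?w F + sum ?w K = sum ?w (F \<union> K)"
      using F K by (simp add: sum.union_disjoint)
    also have "\<dots> \<le> infsum ?w (UNIV - {0})"
      using F K by (intro finite_sum_le_infsum summable_on_inverse_1_plus_int_square) auto
    finally have wF: "sum ?w F \<le> d" using K by linarith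
    have "(1 / real_of_int k)\<^sup>2 \<le> 2 * ?w k" if "k \<in> F" for k
    proof -
      have "k \<noteq> 0" using that F by metis
      then have "1 \<le> (real_of_int k)\<^sup>2"
        using power_mono[of 1 "\<bar>real_of_int k\<bar>" 2] by simp
      then have "2 / ((real_of_int k)\<^sup>2 + (real_of_int k)\<^sup>2) \<le> 2 / (1 + (real_of_int k)\<^sup>2)"
        by (intro divide_left_mono mult_pos_pos) auto
      then show ?thesis by (simp add: power_divide)
    qed
    then have "(\<Sum>k\<in>F. (1 / real_of_int k)\<^sup>2) \<le> (\<Sum>k\<in>F. 2 * ?w k)" by (rule sum_mono)
    also have "\<dots> \<le> 2 * d" using mult_left_mono[OF wF, of 2] by (simp add: sum_distrib_left)
    finally have kF: "(\<Sum>k\<in>F. (1 / real_of_int k)\<^sup>2) \<le> 2 * d" .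
    have "(\<Sum>k\<in>F. \<bar>sinc (x - of_int k)\<bar> / \<bar>of_int k\<bar>) = (\<Sum>k\<in>F. \<bar>sinc (x - of_int k)\<bar> * \<bar>1 / real_of_int k\<bar>)"
      by simp
    also have "\<dots> \<le> L2_set (\<lambda>k. sinc (x - of_int k)) F * L2_set (\<lambda>k. 1 / real_of_int k) F"
      by (rule L2_set_mult_ineq)
    also have "\<dots> \<le> sqrt (C + 1) * sqrt (2 * d)"
      unfolding L2_set_def using kF C(2)[OF F(1), of x] C(1) by (intro mult_mono real_sqrt_le_mono) (auto simp: sum_nonneg)
    also have "\<dots> = sqrt (e\<^sup>2)"
    proof -
      have "(C + 1) * (2 * d) = e\<^sup>2"
        using d_def nonzero_eq_divide_eq[of "2 * (C + 1)" d "e\<^sup>2"] C(1) by (simp add: algebra_simps)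
      then show ?thesis by (simp only: flip: real_sqrt_mult)
    qed
    finally show "(\<Sum>k\<in>F. \<bar>sinc (x - of_int k)\<bar> / \<bar>of_int k\<bar>) \<le> e" using assms by simp
  qed
qed

text \<open>Coefficients of order 1/k reduce both claims to the preceding tail estimate, whose
  independence of \<open>x\<close> gives uniformity for any \<open>u\<close>. The coefficients may
  vary with \<open>t\<close>, as they do in the second series of the theorem.\<close>

lemma
  fixes d :: "int \<Rightarrow> 'b \<Rightarrow> 'a::banach" and u :: "'b \<Rightarrow> real"
  assumes d: "\<And>k t. k \<noteq> 0 \<Longrightarrow> norm (d k t) \<le> B / \<bar>of_int k\<bar>"
  shows summable_on_sinc_series: "(\<lambda>k. sinc (u t - of_int k) *\<^sub>R d k t) summable_on UNIV - {0}"
    and uniform_limit_sinc_series: "uniform_limit UNIV (\<lambda>K t. \<Sum>k\<in>K. sinc (u t - of_int k) *\<^sub>R d k t)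
      (\<lambda>t. \<Sum>\<^sub>\<infinity>k\<in>UNIV - {0}. sinc (u t - of_int k) *\<^sub>R d k t) (finite_subsets_at_top (UNIV - {0}))"
proof -
  define h where "h t k = sinc (u t - of_int k) *\<^sub>R d k t" for t k
  have "norm (d 1 undefined) \<le> B" using d[of 1] by simp
  then have B: "B \<ge> 0" by (rule order_trans[OF norm_ge_zero])
  have sum_h: "(\<Sum>k\<in>F. norm (h t k)) \<le> B * (\<Sum>k\<in>F. \<bar>sinc (u t - of_int k)\<bar> / \<bar>of_int k\<bar>)"
    if "0 \<notin> F" for t F
    unfolding sum_distrib_left
  proof (rule sum_mono)
    fix k assume "k \<in> F"
    then have "k \<noteq> 0" using that by metis
    from mult_left_mono[OF d[OF this], of "\<bar>sinc (u t - of_int k)\<bar>"]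
    show "norm (h t k) \<le> B * (\<bar>sinc (u t - of_int k)\<bar> / \<bar>of_int k\<bar>)"
      by (simp add: h_def mult.commute)
  qed
  have summable: "h t summable_on UNIV - {0}" for t
  proof (rule Infinite_Sum.abs_summable_summable, rule nonneg_bdd_above_summable_on)
    obtain K where K: "finite K" "0 \<notin> K"
      "\<And>F x. \<lbrakk>finite F; F \<inter> K = {}; 0 \<notin> F\<rbrakk> \<Longrightarrow> (\<Sum>k\<in>F. \<bar>sinc (x - of_int k)\<bar> / \<bar>of_int k\<bar>) \<le> 1"
      using sum_sinc_over_index_tail[OF zero_less_one] by blast
    show "bdd_above (sum (\<lambda>k. norm (h t k)) ` {F. F \<subseteq> UNIV - {0} \<and> finite F})"
    proof (rule bdd_aboveI2)
      fix F :: "int set" assume F: "F \<in> {F. F \<subseteq> UNIV - {0} \<and> finite F}"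
      have "(\<Sum>k\<in>F. norm (h t k)) \<le> (\<Sum>k\<in>K \<union> (F - K). norm (h t k))"
        using F K(1,2) by (intro sum_mono2) auto
      also have "\<dots> = (\<Sum>k\<in>K. norm (h t k)) + (\<Sum>k\<in>F - K. norm (h t k))"
        using F K(1,2) by (intro sum.union_disjoint) auto
      also have "(\<Sum>k\<in>F - K. norm (h t k)) \<le> B * 1"
        using F by (intro order_trans[OF sum_h] mult_left_mono K B) auto
      finally show "(\<Sum>k\<in>F. norm (h t k)) \<le> (\<Sum>k\<in>K. norm (h t k)) + B * 1" by simp
    qed
  qed simp
  have "uniform_limit UNIV (\<lambda>K t. sum (h t) K) (\<lambda>t. infsum (h t) (UNIV - {0})) (finite_subsets_at_top (UNIV - {0}))"
  proof (rule uniform_limitI)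
    fix e :: real assume e: "e > 0"
    \<comment> \<open>Dividing by \<open>B + 1\<close> covers B = 0; the half restores strictness
      after the passage to the limit, which preserves only \<le>.\<close>
    define e' where "e' = e / 2 / (B + 1)"
    have "e' > 0" using e B by (simp add: e'_def)
    obtain K where K: "finite K" "0 \<notin> K"
      "\<And>F x. \<lbrakk>finite F; F \<inter> K = {}; 0 \<notin> F\<rbrakk> \<Longrightarrow> (\<Sum>k\<in>F. \<bar>sinc (x - of_int k)\<bar> / \<bar>of_int k\<bar>) \<le> e'"
      using sum_sinc_over_index_tail[OF \<open>e' > 0\<close>] by blast
    have "dist (sum (h t) F) (infsum (h t) (UNIV - {0})) < e"
      if F: "finite F" "K \<subseteq> F" "F \<subseteq> UNIV - {0}" for F t
    proof -
      \<comment> \<open>A larger finite set \<open>G\<close> changes the sum by at most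
        \<open>B * e'\<close>; letting \<open>G\<close> grow compares \<open>F\<close> with the full
        sum.\<close>
      have "((\<lambda>G. dist (sum (h t) F) (sum (h t) G)) \<longlongrightarrow> dist (sum (h t) F) (infsum (h t) (UNIV - {0})))
          (finite_subsets_at_top (UNIV - {0}))"
        by (intro tendsto_dist tendsto_const infsum_tendsto summable)
      moreover have "\<forall>\<^sub>F G in finite_subsets_at_top (UNIV - {0}). dist (sum (h t) F) (sum (h t) G) \<le> B * e'"
        unfolding eventually_finite_subsets_at_top
      proof (intro exI[of _ F] conjI allI impI)
        fix G assume G: "finite G \<and> F \<subseteq> G \<and> G \<subseteq> UNIV - {0}"
        have "dist (sum (h t) F) (sum (h t) G) = norm (sum (h t) (G - F))"
          using G F by (simp add: dist_norm norm_minus_commute sum_diff)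
        also have "\<dots> \<le> (\<Sum>k\<in>G - F. norm (h t k))" by (rule norm_sum)
        also have "\<dots> \<le> B * e'"
          using F G by (intro order_trans[OF sum_h] mult_left_mono K B) auto
        finally show "dist (sum (h t) F) (sum (h t) G) \<le> B * e'" .
      qed (use F in auto)
      ultimately have "dist (sum (h t) F) (infsum (h t) (UNIV - {0})) \<le> B * e'"
        by (rule tendsto_upperbound) simp
      also have "\<dots> \<le> (B + 1) * e'" using \<open>e' > 0\<close> by (simp add: mult_right_mono)
      also have "\<dots> = e / 2"
        using e'_def nonzero_eq_divide_eq[of "B + 1" e' "e / 2"] B by (simp add: mult.commute)
      finally show ?thesis using e by simp
    qed
    then show "\<forall>\<^sub>F F in finite_subsets_at_top (UNIV - {0}). \<forall>t\<in>UNIV. dist (sum (h t) F) (infsum (h t) (UNIV - {0})) < e"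
      unfolding eventually_finite_subsets_at_top using K(1,2) by (intro exI[of _ K]) auto
  qed
  then show "uniform_limit UNIV (\<lambda>K t. \<Sum>k\<in>K. sinc (u t - of_int k) *\<^sub>R d k t)
      (\<lambda>t. \<Sum>\<^sub>\<infinity>k\<in>UNIV - {0}. sinc (u t - of_int k) *\<^sub>R d k t) (finite_subsets_at_top (UNIV - {0}))"
    by (simp add: h_def[abs_def])
  show "(\<lambda>k. sinc (u t - of_int k) *\<^sub>R d k t) summable_on UNIV - {0}"
    using summable[of t] by (simp add: h_def[abs_def])
qed

subsection \<open>The sampling formula\<close>

text \<open>Rewrites the residue coefficients as sinc values, using that cos(k pi) is 1 or -1 and
  hence its own inverse.\<close>

lemma sinc_shift:
  assumes "x \<noteq> of_int k * pi"
  shows "sinc (x / pi - of_int k) = sin x / ((x - of_int k * pi) * cos (of_int k * pi))"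
proof -
  have s: "sin (of_int k * pi) = 0" and c: "(cos (of_int k * pi))\<^sup>2 = 1"
    using cos_npi_int[of k] by (auto simp: sin_times_pi_eq_0 mult.commute)
  have eq: "pi * (x / pi - of_int k) = x - of_int k * pi"
    by (simp add: field_simps)
  have "sin (x - of_int k * pi) = sin x * cos (of_int k * pi)"
    using s by (simp add: sin_diff)
  also have "\<dots> = sin x / cos (of_int k * pi)"
    using c cos_npi_int[of k] by (auto simp: mult.commute)
  finally have "sin (x - of_int k * pi) = sin x / cos (of_int k * pi)" .
  moreover have "x / pi - of_int k \<noteq> 0" using assms by (simp add: field_simps)
  ultimately have "sinc (x / pi - of_int k) = sin x / cos (of_int k * pi) / (x - of_int k * pi)"
    by (simp only: sinc_def eq if_False)
  then show ?thesis by (simp only: divide_divide_eq_left mult.commute)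
qed

text \<open>Connects the symmetric partial sums produced by the circles with the unordered sum over
  all nonzero integers.\<close>

lemma filterlim_int_intervals_minus_0:
  "filterlim (\<lambda>N. {-int N..int N} - {0}) (finite_subsets_at_top (UNIV - {0})) sequentially"
  unfolding filterlim_def le_filter_def eventually_filtermap
proof (intro allI impI)
  fix P :: "int set \<Rightarrow> bool" assume "eventually P (finite_subsets_at_top (UNIV - {0}))"
  then obtain X where X: "finite X" "X \<subseteq> UNIV - {0}"
    "\<forall>Y. finite Y \<and> X \<subseteq> Y \<and> Y \<subseteq> UNIV - {0} \<longrightarrow> P Y"
    unfolding eventually_finite_subsets_at_top by blast
  \<comment> \<open>The sum of all |k| over \<open>X\<close> is a bound for each of them and also
    makes sense for empty \<open>X\<close>.\<close>
  define m where "m = nat (\<Sum>k\<in>X. \<bar>k\<bar>)"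
  have "P ({-int N..int N} - {0})" if "m \<le> N" for N
  proof (rule X(3)[rule_format], intro conjI)
    show "X \<subseteq> {-int N..int N} - {0}"
    proof
      fix k assume k: "k \<in> X"
      then have "\<bar>k\<bar> \<le> (\<Sum>k\<in>X. \<bar>k\<bar>)" using X(1) by (intro member_le_sum) auto
      with that have "\<bar>k\<bar> \<le> int N" by (simp add: m_def)
      with k X(2) show "k \<in> {-int N..int N} - {0}" by auto
    qed
  qed auto
  then show "\<forall>\<^sub>F N in sequentially. P ({-int N..int N} - {0})"
    using eventually_ge_at_top[of m] by (rule eventually_mono[rotated])
qed

context isometry_group
begin

text \<open>Both orbit points have norm \<open>norm x\<close>. The shift \<open>t\<close> serves the
  second series; for k = 0 division by zero makes both sides 0.\<close>

lemma norm_difference_quotient_le: "norm ((U (s + t) x - U t x) /\<^sub>R (of_int k * h)) \<le> (2 * norm x / \<bar>h\<bar>) / \<bar>of_int k\<bar>"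
proof -
  have "norm (U (s + t) x - U t x) \<le> 2 * norm x"
    using norm_triangle_ineq4[of "U (s + t) x" "U t x"] by (simp add: norm)
  then have "norm (U (s + t) x - U t x) / (\<bar>of_int k\<bar> * \<bar>h\<bar>) \<le> 2 * norm x / (\<bar>of_int k\<bar> * \<bar>h\<bar>)"
    by (intro divide_right_mono) auto
  then show ?thesis by (simp add: abs_mult divide_inverse mult_ac)
qed

text \<open>The cardinal series is applied to H(z) = (G(z) - G(0))/z instead of \<open>G\<close>,
  since dividing by z gives the decay that the contour argument needs; multiplying by
  \<open>x\<close> recovers the orbit. The condition on \<open>sin x\<close> keeps \<open>x\<close>
  off the nodes.\<close>

lemma sampling_formula_nonzero:
  fixes a :: "nat \<Rightarrow> 'a" and x :: real
  assumes a: "\<And>m s. ((\<lambda>s. U s (a m)) has_vector_derivative U s (a (Suc m))) (at s)"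
    and M: "\<And>m. norm (a m) \<le> M" and sinx: "sin x \<noteq> 0"
  shows "U x (a 0) = a 0 + (x * sinc (x / pi)) *\<^sub>R a 1 +
    x *\<^sub>R (\<Sum>\<^sub>\<infinity>k\<in>UNIV - {0::int}. sinc (x / pi - of_int k) *\<^sub>R ((U (of_int k * pi) (a 0) - a 0) /\<^sub>R (of_int k * pi)))"
proof -
  define G where "G z = (\<Sum>n. (z ^ n / fact n) *\<^sub>C a n)" for z
  \<comment> \<open>These are the Taylor coefficients of \<open>H\<close>. Defining \<open>H\<close>
    by its series rather than as a quotient yields H(0) = a 1, the source of the derivative
    term.\<close>
  define b where "b n = (1 / fact (Suc n)) *\<^sub>R a (Suc n)" for n
  define H where "H z = (\<Sum>n. z ^ n *\<^sub>C b n)" for z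
  have G: "(\<lambda>n. (z ^ n / fact n) *\<^sub>C a n) sums G z" "norm (G z) \<le> M * exp \<bar>Im z\<bar>" for z
  proof -
    obtain S where "((\<lambda>n. (z ^ n / fact n) *\<^sub>C a n) has_sum S) UNIV" "norm S \<le> M * exp \<bar>Im z\<bar>"
      using has_sum_orbit[of a, OF a M] by blast
    moreover from this(1) have "(\<lambda>n. (z ^ n / fact n) *\<^sub>C a n) sums S" by (rule has_sum_imp_sums)
    ultimately show "(\<lambda>n. (z ^ n / fact n) *\<^sub>C a n) sums G z" "norm (G z) \<le> M * exp \<bar>Im z\<bar>"
      by (auto simp: G_def sums_iff)
  qed
  have G_real: "G (of_real s) = U s (a 0)" for s
  proof -
    have "(\<lambda>n. (s ^ n / fact n) *\<^sub>R U 0 (a n)) sums U s (a 0)"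
      by (rule Taylor_sums[where M = M]) (simp_all add: a norm M)
    then have "(\<lambda>n. (of_real s ^ n / fact n) *\<^sub>C a n) sums U s (a 0)"
      by (simp add: zero flip: scaleC_of_real)
    with G(1)[of "of_real s"] show ?thesis by (rule sums_unique2)
  qed
  have zH: "(\<lambda>n. z *\<^sub>C (z ^ n *\<^sub>C b n)) sums (G z - a 0)" for z
  proof -
    have "(\<lambda>n. (z ^ Suc n / fact (Suc n)) *\<^sub>C a (Suc n)) sums (G z - a 0)"
      using G(1)[of z] by (subst sums_Suc_iff) (simp add: scaleC_of_real[of 1, simplified])
    moreover have "(z ^ Suc n / fact (Suc n)) *\<^sub>C a (Suc n) = z *\<^sub>C (z ^ n *\<^sub>C b n)" for n
      by (simp add: b_def scaleC_scaleC divide_inverse mult.assoc flip: scaleC_of_real)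
    ultimately show ?thesis by simp
  qed
  have summable_b: "summable (\<lambda>n. r ^ n * norm (b n))" if "0 \<le> r" for r
  proof (rule summable_comparison_test')
    show "summable (\<lambda>n. inverse (fact n) * r ^ n * M)"
      by (intro summable_mult2 summable_exp)
    show "norm (r ^ n * norm (b n)) \<le> inverse (fact n) * r ^ n * M" if "n \<ge> 0" for n
    proof -
      have "norm (b n) = norm (a (Suc n)) / fact (Suc n)" by (simp add: b_def)
      also have "\<dots> \<le> M / fact n"
        using M[of "Suc n"] order_trans[OF norm_ge_zero M] by (intro frac_le fact_mono) auto
      finally have "r ^ n * norm (b n) \<le> r ^ n * (M / fact n)"
        using \<open>0 \<le> r\<close> by (intro mult_left_mono) auto
      then show ?thesis using \<open>0 \<le> r\<close> by (simp add: field_simps)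
    qed
  qed
  have H: "(\<lambda>n. z ^ n *\<^sub>C b n) sums H z" for z
  proof -
    have "summable (\<lambda>n. norm (z ^ n *\<^sub>C b n))"
      using summable_b[of "cmod z"] by (simp add: norm_scaleC norm_power)
    then show ?thesis unfolding H_def by (rule summable_sums[OF summable_norm_cancel])
  qed
  have zH_eq: "z *\<^sub>C H z = G z - a 0" for z
    using bounded_linear.sums[OF scaleC.bounded_linear_right H] zH by (rule sums_unique2)
  have H0: "H 0 = a 1"
  proof -
    have "(\<lambda>n. 0 ^ n *\<^sub>C b n) sums (0 ^ 0 *\<^sub>C b 0)"
    proof -
      have eq: "0 ^ n *\<^sub>C b n = 0" if "n \<notin> {0}" for n
        using that by (simp add: zero_power scaleC.zero_left)
      show ?thesis
        using sums_finite[of "{0}" "\<lambda>n. 0 ^ n *\<^sub>C b n", OF _ eq] by simp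
    qed
    with H[of 0] have "H 0 = 0 ^ 0 *\<^sub>C b 0" by (rule sums_unique2)
    then show ?thesis by (simp add: b_def scaleC_of_real[of 1, simplified])
  qed
  have H_real: "H (of_real s) = (U s (a 0) - a 0) /\<^sub>R s" if "s \<noteq> 0" for s
  proof -
    have "s *\<^sub>R H (of_real s) = U s (a 0) - a 0"
      using zH_eq[of "of_real s"] by (simp add: scaleC_of_real G_real)
    then show ?thesis using that by (metis scaleR_scaleR left_inverse scaleR_one)
  qed
  have K: "norm (z *\<^sub>C H z) \<le> (2 * M) * exp \<bar>Im z\<bar>" for z
  proof -
    have "M * 1 \<le> M * exp \<bar>Im z\<bar>"
      using order_trans[OF norm_ge_zero M] by (intro mult_left_mono) auto
    then show ?thesis
      using norm_triangle_ineq4[of "G z" "a 0"] G(2)[of z] M[of 0] unfolding zH_eq by linarith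
  qed
  have xk: "x \<noteq> of_int k * pi" for k
    using sinx by (auto simp: sin_times_pi_eq_0)
  have x0: "x \<noteq> 0" using sinx by auto
  define h where "h k = sinc (x / pi - of_int k) *\<^sub>R ((U (of_int k * pi) (a 0) - a 0) /\<^sub>R (of_int k * pi))" for k :: int
  have "(\<lambda>N. sinc (x / pi) *\<^sub>R a 1 + sum h ({-int N..int N} - {0})) \<longlonglongrightarrow> H (of_real x)"
  proof -
    have "(\<Sum>k=-int N..int N. (sin x / ((x - k * pi) * cos (k * pi))) *\<^sub>R H (of_real (k * pi)))
        = sinc (x / pi) *\<^sub>R a 1 + sum h ({-int N..int N} - {0})" for N
    proof -
      have "(\<Sum>k=-int N..int N. (sin x / ((x - k * pi) * cos (k * pi))) *\<^sub>R H (of_real (k * pi)))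
        = (\<Sum>k=-int N..int N. sinc (x / pi - of_int k) *\<^sub>R H (of_real (k * pi)))"
        by (simp only: sinc_shift[OF xk])
      also have "\<dots> = sinc (x / pi) *\<^sub>R a 1 + (\<Sum>k\<in>{-int N..int N} - {0}. sinc (x / pi - of_int k) *\<^sub>R H (of_real (k * pi)))"
        by (subst sum.remove[of _ 0]) (auto simp: H0)
      also have "(\<Sum>k\<in>{-int N..int N} - {0}. sinc (x / pi - of_int k) *\<^sub>R H (of_real (k * pi))) = sum h ({-int N..int N} - {0})"
        by (intro sum.cong refl) (simp add: h_def H_real del: of_real_mult)
      finally show ?thesis .
    qed
    with sampling_symmetric_partial_sums[OF H summable_b K sinx] show ?thesis by simp
  qed
  \<comment> \<open>The same partial sums also converge to the unordered sum, so the two limits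
    agree.\<close>
  moreover have "(\<lambda>N. sinc (x / pi) *\<^sub>R a 1 + sum h ({-int N..int N} - {0})) \<longlonglongrightarrow> sinc (x / pi) *\<^sub>R a 1 + infsum h (UNIV - {0})"
  proof (intro tendsto_add tendsto_const filterlim_compose[OF infsum_tendsto filterlim_int_intervals_minus_0])
    have "norm ((U (of_int k * pi) (a 0) - a 0) /\<^sub>R (of_int k * pi)) \<le> (2 * norm (a 0) / \<bar>pi\<bar>) / \<bar>of_int k\<bar>" for k
      using norm_difference_quotient_le[where s = "of_int k * pi" and t = 0 and x = "a 0" and h = pi] by (simp add: zero)
    from summable_on_sinc_series[OF this, of "\<lambda>_. x / pi"]
    show "h summable_on UNIV - {0}" unfolding h_def[abs_def] .
  qed
  ultimately have "H (of_real x) = sinc (x / pi) *\<^sub>R a 1 + infsum h (UNIV - {0})"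
    by (rule LIMSEQ_unique)
  then have "x *\<^sub>R H (of_real x) = (x * sinc (x / pi)) *\<^sub>R a 1 + x *\<^sub>R infsum h (UNIV - {0})"
    by (simp add: scaleR_add_right)
  moreover have "x *\<^sub>R H (of_real x) = U x (a 0) - a 0"
    using x0 by (simp add: H_real)
  ultimately show ?thesis unfolding h_def[abs_def] by (simp add: algebra_simps)
qed

text \<open>At a node x = m pi the sinc factors become a Kronecker delta: for m = 0 the identity is
  trivial, otherwise only the term k = m survives and equals (U x f - f)/x with f =
  \<open>a 0\<close>.\<close>

lemma sampling_formula:
  fixes a :: "nat \<Rightarrow> 'a" and x :: real
  assumes a: "\<And>m s. ((\<lambda>s. U s (a m)) has_vector_derivative U s (a (Suc m))) (at s)"
    and M: "\<And>m. norm (a m) \<le> M"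
  shows "U x (a 0) = a 0 + (x * sinc (x / pi)) *\<^sub>R a 1 +
    x *\<^sub>R (\<Sum>\<^sub>\<infinity>k\<in>UNIV - {0::int}. sinc (x / pi - of_int k) *\<^sub>R ((U (of_int k * pi) (a 0) - a 0) /\<^sub>R (of_int k * pi)))"
proof (cases "sin x = 0")
  case False
  with a M show ?thesis by (rule sampling_formula_nonzero)
next
  case True
  then obtain m :: int where m: "x = of_int m * pi"
    by (auto simp: sin_zero_iff_int2)
  have sinc_int: "sinc (of_int k) = (if k = 0 then 1 else 0)" for k
    by (simp add: sinc_def)
  show ?thesis
  proof (cases "m = 0")
    case True
    then show ?thesis using m by (simp add: zero)
  next
    case False
    let ?h = "\<lambda>k::int. sinc (x / pi - of_int k) *\<^sub>R ((U (of_int k * pi) (a 0) - a 0) /\<^sub>R (of_int k * pi))"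
    have xpi: "x / pi - of_int k = of_int (m - k)" for k by (simp add: m)
    have "infsum ?h (UNIV - {0}) = infsum ?h {m}"
      by (rule infsum_cong_neutral) (use False in \<open>auto simp: xpi sinc_int simp del: of_int_diff\<close>)
    also have "\<dots> = (U x (a 0) - a 0) /\<^sub>R x"
      by (simp add: xpi sinc_int m sinc_def)
    finally have "infsum ?h (UNIV - {0}) = (U x (a 0) - a 0) /\<^sub>R x" .
    moreover have "sinc (x / pi) = 0" using sinc_int[of m] False by (simp add: m)
    moreover have "x \<noteq> 0" using False by (simp add: m)
    ultimately show ?thesis by simp
  qed
qed

end

section \<open>Orbits of generator domain vectors and the theorem for general \<sigma>\<close>

lemma (in isometry_group) generator_has_vector_derivative:
  assumes "generator U x = Some y"
  shows "((\<lambda>s. U s x) has_vector_derivative U t y) (at t)"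
proof -
  have "((\<lambda>s. (U s x - x) /\<^sub>R s) \<longlongrightarrow> y) (at 0)"
    using assms tendsto_Lim[OF trivial_limit_at[of "0::real"]]
    by (auto simp: generator_def Let_def split: if_splits)
  then have "((\<lambda>s. norm ((U s x - x) /\<^sub>R s - y)) \<longlongrightarrow> 0) (at 0)"
    by (intro tendsto_norm_zero LIM_zero)
  moreover have "norm ((U s x - x) /\<^sub>R s - y) = norm (U s x - x - s *\<^sub>R y) / \<bar>s\<bar>" if "s \<noteq> 0" for s
  proof -
    have "(U s x - x) /\<^sub>R s - y = (U s x - x - s *\<^sub>R y) /\<^sub>R s"
      using that by (simp add: scaleR_diff_right)
    then show ?thesis by (simp add: divide_inverse mult.commute)
  qed
  then have "\<forall>\<^sub>F s in at 0. norm ((U s x - x) /\<^sub>R s - y) = norm (U s x - x - s *\<^sub>R y) / \<bar>s\<bar>"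
    by (auto simp: eventually_at_filter)
  ultimately have "((\<lambda>s. norm (U s x - x - s *\<^sub>R y) / \<bar>s\<bar>) \<longlongrightarrow> 0) (at 0)"
    by (rule Lim_transform_eventually)
  then have "((\<lambda>s. U s x) has_vector_derivative y) (at (t - t))"
    by (simp add: has_vector_derivative_def has_derivative_iff_norm zero bounded_linear_scaleR_left)
  \<comment> \<open>The derivative at 0 is transported to \<open>t\<close> by writing
    \<open>U s x\<close> as \<open>U t (U (s - t) x)\<close>.\<close>
  then have "((\<lambda>s. U s x) \<circ> (\<lambda>s. s - t) has_vector_derivative 1 *\<^sub>R y) (at t)"
    by (intro vector_diff_chain_at) (auto intro!: derivative_eq_intros)
  then have "((\<lambda>s. U t (U (s - t) x)) has_vector_derivative U t y) (at t)"
    using bounded_linear.has_vector_derivative[OF bounded_linear] by (simp add: o_def)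
  then show ?thesis by (simp flip: group)
qed

text \<open>The series are unordered sums, and the \<open>uniform_limit\<close> clauses run along
  all finite sets of nonzero integers. They imply summability for each \<open>t\<close>, so the
  value 0 that \<open>infsum\<close> takes on families without a sum never stands in for a missing
  limit.\<close>

theorem theorem8p2:
  fixes U :: "real \<Rightarrow> 'a::complex_banach \<Rightarrow> 'a"
    and D :: "'a \<Rightarrow> 'a option" and f :: 'a and \<sigma> :: real
  assumes "isometry_group U" and "D = generator U" and "\<sigma> > 0"
    and "f \<in> bernstein_space \<sigma> D"
  shows "(\<forall>t. U t f = f + (t * sinc (\<sigma> * t / pi)) *\<^sub>R the (D f)
           + t *\<^sub>R (\<Sum>\<^sub>\<infinity>k\<in>UNIV - {0::int}.
               sinc (\<sigma> * t / pi - of_int k) *\<^sub>R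
                 ((U (of_int k * pi / \<sigma>) f - f) /\<^sub>R (of_int k * pi / \<sigma>))))
    \<and> (\<forall>t. f = U t f - (t * sinc (\<sigma> * t / pi)) *\<^sub>R U t (the (D f))
           - t *\<^sub>R (\<Sum>\<^sub>\<infinity>k\<in>UNIV - {0::int}.
               sinc (\<sigma> * t / pi + of_int k) *\<^sub>R
                 ((U (of_int k * pi / \<sigma> + t) f - U t f) /\<^sub>R (of_int k * pi / \<sigma>))))
    \<and> uniform_limit UNIV
           (\<lambda>K t. \<Sum>k\<in>K. sinc (\<sigma> * t / pi - of_int k) *\<^sub>R
                 ((U (of_int k * pi / \<sigma>) f - f) /\<^sub>R (of_int k * pi / \<sigma>)))
           (\<lambda>t. \<Sum>\<^sub>\<infinity>k\<in>UNIV - {0::int}. sinc (\<sigma> * t / pi - of_int k) *\<^sub>R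
                 ((U (of_int k * pi / \<sigma>) f - f) /\<^sub>R (of_int k * pi / \<sigma>)))
           (finite_subsets_at_top (UNIV - {0::int}))
    \<and> uniform_limit UNIV
           (\<lambda>K t. \<Sum>k\<in>K. sinc (\<sigma> * t / pi + of_int k) *\<^sub>R
                 ((U (of_int k * pi / \<sigma> + t) f - U t f) /\<^sub>R (of_int k * pi / \<sigma>)))
           (\<lambda>t. \<Sum>\<^sub>\<infinity>k\<in>UNIV - {0::int}. sinc (\<sigma> * t / pi + of_int k) *\<^sub>R
                 ((U (of_int k * pi / \<sigma> + t) f - U t f) /\<^sub>R (of_int k * pi / \<sigma>)))
           (finite_subsets_at_top (UNIV - {0::int}))"
proof -
  interpret isometry_group U by fact
  define a where "a n = the (op_power D n f)" for n
  have op_power: "op_power D n f = Some (a n)" for n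
  proof -
    have "f \<in> dom (op_power D n)"
      using assms(4) by (simp add: bernstein_space_def smooth_domain_def)
    then show ?thesis by (auto simp: a_def)
  qed
  have a0: "a 0 = f" by (simp add: a_def)
  have D: "generator U (a n) = Some (a (Suc n))" for n
    using op_power[of "Suc n"] op_power[of n] assms(2) by simp
  have Df: "the (D f) = a 1" using D[of 0] a0 assms(2) by simp
  \<comment> \<open>The slowed group has generator D / \<sigma>, whose powers send f to
    \<open>a' n\<close>; all these vectors have norm at most \<open>norm f\<close>, which is the
    case \<sigma> = 1.\<close>
  define V where "V s = U (s / \<sigma>)" for s
  define a' where "a' n = a n /\<^sub>R \<sigma> ^ n" for n
  interpret V: isometry_group V
  proof
    show "continuous_on UNIV (\<lambda>s. V s x)" for x
      unfolding V_def by (rule continuous_on_compose2[OF strongly_continuous]) (use assms(3) in \<open>auto intro!: continuous_intros\<close>)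
  qed (simp_all add: V_def add scaleC norm zero add_divide_distrib group)
  have V_deriv: "((\<lambda>s. V s (a' m)) has_vector_derivative V s (a' (Suc m))) (at s)" for m s
  proof -
    have "((\<lambda>s. U s (a m)) \<circ> (\<lambda>s. s / \<sigma>) has_vector_derivative (1 / \<sigma>) *\<^sub>R U (s / \<sigma>) (a (Suc m))) (at s)"
      by (rule vector_diff_chain_at)
        (use assms(3) in \<open>auto intro!: derivative_eq_intros generator_has_vector_derivative D\<close>)
    from bounded_linear.has_vector_derivative[OF bounded_linear_scaleR_right[of "inverse (\<sigma> ^ m)"] this]
    show ?thesis by (simp add: V_def a'_def o_def linear_scale[OF linear] divide_inverse mult.commute)
  qed
  \<comment> \<open>The space prescribes the bound for exponents from 1 on; for m = 0 it holds
    because a 0 = f.\<close>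
  have "norm (a m) \<le> \<sigma> ^ m * norm f" for m
    using assms(4) by (cases m) (auto simp: bernstein_space_def a_def)
  then have norm_a': "norm (a' m) \<le> norm f" for m
    using assms(3) by (simp add: a'_def field_simps)
  define h where "h t k = sinc (\<sigma> * t / pi - of_int k) *\<^sub>R
      ((U (of_int k * pi / \<sigma>) f - f) /\<^sub>R (of_int k * pi / \<sigma>))" for t and k :: int
  define h' where "h' t k = sinc (\<sigma> * t / pi + of_int k) *\<^sub>R
      ((U (of_int k * pi / \<sigma> + t) f - U t f) /\<^sub>R (of_int k * pi / \<sigma>))" for t and k :: int
  have quotient_bound: "norm ((U (of_int k * pi / \<sigma> + t) f - U t f) /\<^sub>R (of_int k * pi / \<sigma>))
      \<le> (2 * norm f / \<bar>pi / \<sigma>\<bar>) / \<bar>of_int k\<bar>" for k t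
    using norm_difference_quotient_le[where s = "of_int k * pi / \<sigma>" and h = "pi / \<sigma>"] by simp
  have quotient_bound_0: "norm ((U (of_int k * pi / \<sigma>) f - f) /\<^sub>R (of_int k * pi / \<sigma>))
      \<le> (2 * norm f / \<bar>pi / \<sigma>\<bar>) / \<bar>of_int k\<bar>" for k
    using quotient_bound[of k 0] by (simp add: zero)
  have summable_h: "h t summable_on UNIV - {0}" for t
    unfolding h_def
    by (rule summable_on_sinc_series[where d = "\<lambda>k _. (U (of_int k * pi / \<sigma>) f - f) /\<^sub>R (of_int k * pi / \<sigma>)"
          and u = "\<lambda>_. \<sigma> * t / pi"]) (rule quotient_bound_0)
  have formula: "U t f = f + (t * sinc (\<sigma> * t / pi)) *\<^sub>R a 1 + t *\<^sub>R infsum (h t) (UNIV - {0})" for t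
  proof -
    let ?g = "\<lambda>k::int. sinc (\<sigma> * t / pi - of_int k) *\<^sub>R ((U (of_int k * pi / \<sigma>) f - f) /\<^sub>R (of_int k * pi))"
    \<comment> \<open>For \<open>V\<close> the quotients have denominator \<open>k * pi\<close>
      instead of \<open>k * pi / \<sigma>\<close>; the factor \<sigma> is absorbed when \<sigma> t
      replaces t as prefactor.\<close>
    have "h t = (\<lambda>k. \<sigma> *\<^sub>R ?g k)"
      by (auto simp: h_def divide_inverse mult_ac)
    then have "infsum (h t) (UNIV - {0}) = \<sigma> *\<^sub>R infsum ?g (UNIV - {0})"
      by (simp only: infsum_scaleR_right)
    with V.sampling_formula[of a', OF V_deriv norm_a', of "\<sigma> * t"] assms(3) show ?thesis
      by (simp add: V_def a'_def a0 mult_ac)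
  qed
  have formula': "f = U t f - (t * sinc (\<sigma> * t / pi)) *\<^sub>R U t (a 1) - t *\<^sub>R infsum (h' t) (UNIV - {0})" for t
  proof -
    have "(h (- t) has_sum infsum (h (- t)) (UNIV - {0})) (UNIV - {0})"
      by (intro has_sum_infsum summable_h)
    from has_sum_bounded_linear[OF bounded_linear this, of t]
    have "((\<lambda>k. U t (h (- t) k)) has_sum U t (infsum (h (- t)) (UNIV - {0}))) (UNIV - {0})" .
    \<comment> \<open>Applying \<open>U t\<close> to the first formula at -t shifts the orbit points
      by t, and evenness of sinc turns the argument into \<sigma> t / pi + k.\<close>
    moreover have "U t (h (- t) k) = h' t k" for k
    proof -
      have "sinc (\<sigma> * (- t) / pi - of_int k) = sinc (\<sigma> * t / pi + of_int k)"
        using sinc_minus[of "\<sigma> * t / pi + of_int k"] by simp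
      then show ?thesis
        by (simp add: h_def h'_def linear_scale[OF linear] linear_diff[OF linear] add.commute flip: group)
    qed
    ultimately have "U t (infsum (h (- t)) (UNIV - {0})) = infsum (h' t) (UNIV - {0})"
      by (simp add: infsumI)
    moreover have "f = U t (U (- t) f)" by (simp add: zero flip: group)
    ultimately show ?thesis
      using sinc_minus[of "\<sigma> * t / pi"]
      by (subst (asm) formula) (simp add: linear_scale[OF linear] linear_add[OF linear] linear_diff[OF linear])
  qed
  have uniform: "uniform_limit UNIV (\<lambda>K t. sum (h t) K) (\<lambda>t. infsum (h t) (UNIV - {0})) (finite_subsets_at_top (UNIV - {0}))"
    unfolding h_def[abs_def]
    by (rule uniform_limit_sinc_series[where d = "\<lambda>k _. (U (of_int k * pi / \<sigma>) f - f) /\<^sub>R (of_int k * pi / \<sigma>)"])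
      (rule quotient_bound_0)
  \<comment> \<open>Evenness of sinc brings the plus sign into the form \<open>u t - k\<close> with
    u t = -(\<sigma> t / pi), so the same convergence lemma applies.\<close>
  have h'_eq: "h' = (\<lambda>t k. sinc (- (\<sigma> * t / pi) - of_int k) *\<^sub>R
      ((U (of_int k * pi / \<sigma> + t) f - U t f) /\<^sub>R (of_int k * pi / \<sigma>)))"
    using sinc_minus[of "\<sigma> * t / pi + of_int k" for t k] by (intro ext) (simp add: h'_def)
  have uniform': "uniform_limit UNIV (\<lambda>K t. sum (h' t) K) (\<lambda>t. infsum (h' t) (UNIV - {0})) (finite_subsets_at_top (UNIV - {0}))"
    unfolding h'_eq by (rule uniform_limit_sinc_series) (rule quotient_bound)
  from formula formula' uniform uniform' show ?thesis
    unfolding h_def[abs_def] h'_def[abs_def] Df by blast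
qed

end
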